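(* Let $1\le p<2$. Let $F:\mathbb{T}\to\mathbb{C}$ be such that $t\mapsto F(e^{it})$ is absolutely continuous on $[0,2\pi]$ (with $F(e^{i0})=F(e^{i2\pi})$), and suppose $\dot F\in L^p(0,2\pi)$, where $\dot F(e^{it})=\frac{d}{dt}F(e^{it})$. Let $w=P[F]$. Then $$\|w_z\|_{L^p}\le\left(C(p)+\frac{1}{2-p}\right)^{1/p}\|\dot F\|_{L^p}\quad\text{and}\quad \|\overline{w_{\bar z}}\|_{L^p}\le\left(C(p)+\frac{1}{2-p}\right)^{1/p}\|\dot F\|_{L^p},$$ where $C(p)=\int_0^1\left(\frac{4\tanh^{-1}r}{\pi r}\right)^p r\,dr$. In particular $w_z,\overline{w_{\bar z}}\in L^p(\mathbb{D})$.
   Context: $\mathbb{D}$ is the open unit disk and $\mathbb{T}$ the unit circle. For $F\in L^1(\mathbb{T})$, the Poisson integral is $P[F](re^{i\theta})=\int_0^{2\pi}P_r(t-\theta)F(e^{it})\,dt$ with $P_r(t-\theta)=\frac{1}{2\pi}\frac{1-r^2}{1-2r\cos(t-\theta)+r^2}$. $w_z=\frac12(w_x-iw_y)$, $w_{\bar z}=\frac12(w_x+iw_y)$. For $G$ on $[0,2\pi]$, $\|G\|_{L^p}=\left(\frac{1}{2\pi}\int_0^{2\pi}|G(e^{it})|^p\,dt\right)^{1/p}$. For a function $f$ on $\mathbb{D}$, $\|f\|_{L^p}=\left(\int_{\mathbb{D}}|f|^p\,dA\right)^{1/p}$ with $dA=\frac1\pi dx\,dy$ the normalized area measure. $\tanh^{-1}r=\frac12\log\frac{1+r}{1-r}$.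 *)

theory Defs
  imports "HOL-Analysis.Analysis"
begin

definition abs_continuous_on :: "real \<Rightarrow> real \<Rightarrow> (real \<Rightarrow> 'a::real_normed_vector) \<Rightarrow> bool" where
  "abs_continuous_on a b f \<longleftrightarrow>
     (\<forall>e>0. \<exists>d>0. \<forall>(n::nat) (u::nat \<Rightarrow> real) (v::nat \<Rightarrow> real).
        (\<forall>k<n. a \<le> u k \<and> u k \<le> v k \<and> v k \<le> b) \<and>
        (\<forall>k<n. \<forall>j<n. k \<noteq> j \<longrightarrow> v k \<le> u j \<or> v j \<le> u k) \<and>
        (\<Sum>k<n. v k - u k) < d
        \<longrightarrow> (\<Sum>k<n. norm (f (v k) - f (u k))) < e)"

definition poisson_kernel :: "real \<Rightarrow> real \<Rightarrow> real" where
  "poisson_kernel r s = (1 / (2*pi)) * ((1 - r^2) / (1 - 2*r*cos s + r^2))"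

definition poisson_integral :: "(complex \<Rightarrow> complex) \<Rightarrow> complex \<Rightarrow> complex" where
  "poisson_integral F z =
     (LINT t:{0..2*pi}|lborel. complex_of_real (poisson_kernel (cmod z) (t - Arg z)) * F (cis t))"

text \<open>Wirtinger derivatives: w_z = (w_x - i w_y)/2, w_zbar = (w_x + i w_y)/2,
  where w_x, w_y are the real partial derivatives (Frechet derivative applied to 1 and i).\<close>
definition wirt_z :: "(complex \<Rightarrow> complex) \<Rightarrow> complex \<Rightarrow> complex" where
  "wirt_z w z = (frechet_derivative w (at z) 1 - \<i> * frechet_derivative w (at z) \<i>) / 2"

definition wirt_zbar :: "(complex \<Rightarrow> complex) \<Rightarrow> complex \<Rightarrow> complex" where
  "wirt_zbar w z = (frechet_derivative w (at z) 1 + \<i> * frechet_derivative w (at z) \<i>) / 2"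

definition Lp_norm_circle :: "real \<Rightarrow> (real \<Rightarrow> complex) \<Rightarrow> real" where
  "Lp_norm_circle p G = ((1 / (2*pi)) * (LINT t:{0..2*pi}|lborel. cmod (G t) powr p)) powr (1/p)"

definition Lp_norm_disk :: "real \<Rightarrow> (complex \<Rightarrow> complex) \<Rightarrow> real" where
  "Lp_norm_disk p f = ((1 / pi) * (LINT z:ball 0 1|lborel. cmod (f z) powr p)) powr (1/p)"

definition C_const :: "real \<Rightarrow> real" where
  "C_const p = (LINT r:{0<..<1}|lborel. ((4 * artanh r) / (pi * r)) powr p * r)"

end

(*
  With \<zeta> = e^(it), the Poisson kernel is (\<zeta>/(\<zeta>-z) + its conjugate - 1) / (2 pi), so w_z is the
  derivative of the Cauchy transform of F, and the conjugate of w_zbar is that of conj F.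
  Integration by parts turns z w_z into -i/2 times the integral of dF against the Herglotz kernel
  P + iQ, where P is the Poisson kernel and Q its conjugate.  The kernel P has mass 1, and
  |Q| has mass 4 artanh r / pi.  Jensen's inequality for each of the two kernels bounds |w_z|^p
  by an average of |dF|^p against a kernel K(z, \<zeta>) that is invariant under simultaneous rotation.
  Hence the integral of K over the disc does not depend on \<zeta>, and it equals its mean over
  the circle, where the masses of P and |Q| give the two summands 1/(2-p) and C(p).
*)
theory Submission
  imports Defs
begin

section \<open>Absolutely continuous functions\<close>

text \<open>The estimate degenerates in two places, and each gives one summand of the constant.
  Dividing the identity for z w_z by z costs |z|^(-p), whose area integral converges at the origin
  because p < 2; against the mass 1 of P it gives the integral of r^(1-p), which is 1/(2-p). The
  mass \<kappa> = 4 artanh r / pi of |Q| is unbounded near the circle, but only logarithmically: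
  Jensen's inequality contributes \<kappa>^(p-1), the mean over the circle another \<kappa>, and
  r^(-p) \<kappa>^p is the power in the integrand of C(p). The kernels are separated by |P + iQ| <=
  P + |Q| and midpoint convexity, with the 1/2 of the by-parts identity as weight. For every p a
  single factor 1/2 remains, and it turns the 1/pi of the area measure into the 1/(2 pi) of the
  circle norm. F is differentiable only almost everywhere, so integration by parts rests on a
  fundamental theorem for absolutely continuous functions, proved with gauges. Polar coordinates are
  avoided: it is enough that area is invariant under rotations and that |z| has density 2 pi r on
  the disc.\<close>

lemma abs_continuous_onE:
  fixes f :: "real \<Rightarrow> 'a::real_normed_vector"
  assumes "abs_continuous_on a b f" "e > 0"
  obtains d where "d > 0" "\<forall>(n::nat) (u::nat \<Rightarrow> real) (v::nat \<Rightarrow> real).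
        (\<forall>k<n. a \<le> u k \<and> u k \<le> v k \<and> v k \<le> b) \<and>
        (\<forall>k<n. \<forall>j<n. k \<noteq> j \<longrightarrow> v k \<le> u j \<or> v j \<le> u k) \<and>
        (\<Sum>k<n. v k - u k) < d
        \<longrightarrow> (\<Sum>k<n. norm (f (v k) - f (u k))) < e"
  using mp[OF spec[OF assms(1)[unfolded abs_continuous_on_def], of e] assms(2)] by (elim exE conjE)

text \<open>Reindexing along a bijection frees the families from the index set {..<n}, so that the
  tagged intervals of a division can serve directly as indices.\<close>

lemma abs_continuous_on_finite_family:
  fixes f :: "real \<Rightarrow> 'a::real_normed_vector"
  assumes "abs_continuous_on a b f" "e > 0"
  obtains d where "d > 0" "\<forall>I u v. finite (I :: 'i set) \<and>
        (\<forall>i\<in>I. a \<le> u i \<and> u i \<le> v i \<and> v i \<le> b) \<and>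
        (\<forall>i\<in>I. \<forall>j\<in>I. i \<noteq> j \<longrightarrow> v i \<le> u j \<or> v j \<le> u i) \<and>
        (\<Sum>i\<in>I. v i - u i) < d \<longrightarrow> (\<Sum>i\<in>I. norm (f (v i) - f (u i))) < e"
proof -
  obtain d where d: "d > 0" "\<forall>(n::nat) (u::nat \<Rightarrow> real) (v::nat \<Rightarrow> real).
        (\<forall>k<n. a \<le> u k \<and> u k \<le> v k \<and> v k \<le> b) \<and>
        (\<forall>k<n. \<forall>j<n. k \<noteq> j \<longrightarrow> v k \<le> u j \<or> v j \<le> u k) \<and>
        (\<Sum>k<n. v k - u k) < d
        \<longrightarrow> (\<Sum>k<n. norm (f (v k) - f (u k))) < e"
    by (rule abs_continuous_onE[OF assms])
  show thesis
  proof (rule that[OF d(1)], intro allI impI, elim conjE)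
    fix I :: "'i set" and u v
    assume I: "finite I" "\<forall>i\<in>I. a \<le> u i \<and> u i \<le> v i \<and> v i \<le> b"
      "\<forall>i\<in>I. \<forall>j\<in>I. i \<noteq> j \<longrightarrow> v i \<le> u j \<or> v j \<le> u i" "(\<Sum>i\<in>I. v i - u i) < d"
    obtain h where h: "bij_betw h {..<card I} I"
      using ex_bij_betw_nat_finite[OF I(1)] atLeast0LessThan by auto
    have hI: "h k \<in> I" if "k < card I" for k
      using h that by (auto simp: bij_betw_def)
    have hinj: "h k \<noteq> h j" if "k < card I" "j < card I" "k \<noteq> j" for k j
      using h that by (auto simp: bij_betw_def inj_on_def)
    have sum: "(\<Sum>i\<in>I. g i) = (\<Sum>k<card I. g (h k))" for g :: "'i \<Rightarrow> real"
      using sum.reindex_bij_betw[OF h] by metis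
    show "(\<Sum>i\<in>I. norm (f (v i) - f (u i))) < e"
      unfolding sum
    proof (rule d(2)[rule_format], intro conjI allI impI)
      show "v (h k) \<le> u (h j) \<or> v (h j) \<le> u (h k)" if "k < card I" "j < card I" "k \<noteq> j" for k j
        using I(3) hI hinj that by blast
    qed (use I hI in \<open>auto simp: sum\<close>)
  qed
qed

lemma abs_continuous_on_imp_continuous_on:
  fixes f :: "real \<Rightarrow> 'a::real_normed_vector"
  assumes "abs_continuous_on a b f"
  shows "continuous_on {a..b} f"
  unfolding continuous_on_iff
proof (intro ballI allI impI)
  fix x e :: real
  assume x: "x \<in> {a..b}" and e: "e > 0"
  \<comment> \<open>Index type \<open>unit\<close>: the family consists of the single interval
    between \<open>x\<close> and \<open>y\<close>.\<close>
  obtain d where d: "d > 0" and *: "\<forall>I u v. finite (I :: unit set) \<and>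
        (\<forall>i\<in>I. a \<le> u i \<and> u i \<le> v i \<and> v i \<le> b) \<and>
        (\<forall>i\<in>I. \<forall>j\<in>I. i \<noteq> j \<longrightarrow> v i \<le> u j \<or> v j \<le> u i) \<and>
        (\<Sum>i\<in>I. v i - u i) < d \<longrightarrow> (\<Sum>i\<in>I. norm (f (v i) - f (u i))) < e"
    by (rule abs_continuous_on_finite_family[OF assms e])
  have "dist (f y) (f x) < e" if "y \<in> {a..b}" "dist y x < d" for y
    using *[rule_format, of UNIV "\<lambda>_. min x y" "\<lambda>_. max x y"] that x
    by (cases "x \<le> y") (auto simp: dist_norm norm_minus_commute)
  with d show "\<exists>d>0. \<forall>y\<in>{a..b}. dist y x < d \<longrightarrow> dist (f y) (f x) < e" by blast
qed

text \<open>Writing the increment of the product as (f v - f u) g v + f u (g v - g u), absolute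
  continuity of \<open>f\<close> and a bound on \<open>g\<close> control the first term, and the
  Lipschitz constant and a bound on \<open>f\<close> control the second. With the Herglotz kernel as
  \<open>g\<close>, this reduces integration by parts to the fundamental theorem for a
  product.\<close>

lemma abs_continuous_on_mult_lipschitz:
  fixes f g :: "real \<Rightarrow> 'a::real_normed_algebra"
  assumes f: "abs_continuous_on a b f" and g: "L-lipschitz_on {a..b} g"
  shows "abs_continuous_on a b (\<lambda>x. f x * g x)"
proof -
  have L: "L \<ge> 0" using g lipschitz_on_nonneg by blast
  have bounded: "bounded (f ` {a..b})" "bounded (g ` {a..b})"
    using abs_continuous_on_imp_continuous_on[OF f] lipschitz_on_continuous_on[OF g]
    by (auto intro!: compact_imp_bounded compact_continuous_image)
  obtain B where B: "B > 0" "\<And>x. x \<in> {a..b} \<Longrightarrow> norm (f x) \<le> B"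
    using bounded(1) unfolding bounded_pos by blast
  obtain M where M: "M > 0" "\<And>x. x \<in> {a..b} \<Longrightarrow> norm (g x) \<le> M"
    using bounded(2) unfolding bounded_pos by blast
  show ?thesis
    unfolding abs_continuous_on_def
  proof (intro allI impI)
    fix e :: real
    assume e: "e > 0"
    have "e / (2 * M) > 0" using e M by simp
    then obtain d where d: "d > 0" "\<forall>(n::nat) (u::nat \<Rightarrow> real) (v::nat \<Rightarrow> real).
        (\<forall>k<n. a \<le> u k \<and> u k \<le> v k \<and> v k \<le> b) \<and>
        (\<forall>k<n. \<forall>j<n. k \<noteq> j \<longrightarrow> v k \<le> u j \<or> v j \<le> u k) \<and>
        (\<Sum>k<n. v k - u k) < d
        \<longrightarrow> (\<Sum>k<n. norm (f (v k) - f (u k))) < e / (2 * M)"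
      by (rule abs_continuous_onE[OF f])
    \<comment> \<open>The second entry keeps B * L * d' below e / 2; the + 1 guards against L =
      0.\<close>
    define d' where "d' = min d (e / (2 * (B * L + 1)))"
    have BL: "B * L + 1 > 0" using B L by (simp add: add_nonneg_pos)
    have "d' > 0" using d e BL by (simp add: d'_def)
    then show "\<exists>d>0. \<forall>(n::nat) u v. (\<forall>k<n. a \<le> u k \<and> u k \<le> v k \<and> v k \<le> b) \<and>
        (\<forall>k<n. \<forall>j<n. k \<noteq> j \<longrightarrow> v k \<le> u j \<or> v j \<le> u k) \<and> (\<Sum>k<n. v k - u k) < d \<longrightarrow>
        (\<Sum>k<n. norm (f (v k) * g (v k) - f (u k) * g (u k))) < e"
    proof (intro exI[of _ d'] conjI allI impI)
      fix n :: nat and u v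
      assume uv: "(\<forall>k<n. a \<le> u k \<and> u k \<le> v k \<and> v k \<le> b) \<and>
        (\<forall>k<n. \<forall>j<n. k \<noteq> j \<longrightarrow> v k \<le> u j \<or> v j \<le> u k) \<and> (\<Sum>k<n. v k - u k) < d'"
      have "(\<Sum>k<n. norm (f (v k) * g (v k) - f (u k) * g (u k)))
          \<le> (\<Sum>k<n. M * norm (f (v k) - f (u k)) + B * L * (v k - u k))"
      proof (rule sum_mono)
        fix k assume "k \<in> {..<n}"
        then have k: "u k \<in> {a..b}" "v k \<in> {a..b}" "u k \<le> v k" using uv by auto
        have "f (v k) * g (v k) - f (u k) * g (u k)
            = (f (v k) - f (u k)) * g (v k) + f (u k) * (g (v k) - g (u k))"
          by (simp add: algebra_simps)
        also have "norm \<dots> \<le> norm (f (v k) - f (u k)) * norm (g (v k))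
            + norm (f (u k)) * norm (g (v k) - g (u k))"
          by (intro norm_triangle_le add_mono norm_mult_ineq)
        also have "norm (f (v k) - f (u k)) * norm (g (v k)) \<le> norm (f (v k) - f (u k)) * M"
          using M k by (intro mult_left_mono) auto
        also have "norm (f (u k)) * norm (g (v k) - g (u k)) \<le> B * (L * (v k - u k))"
          using lipschitz_onD[OF g k(2,1)] B k L
          by (intro mult_mono) (auto simp: dist_norm)
        finally show "norm (f (v k) * g (v k) - f (u k) * g (u k))
            \<le> M * norm (f (v k) - f (u k)) + B * L * (v k - u k)"
          by (simp add: mult_ac)
      qed
      also have "\<dots> = M * (\<Sum>k<n. norm (f (v k) - f (u k))) + B * L * (\<Sum>k<n. v k - u k)"
        by (simp add: sum.distrib sum_distrib_left)
      also have "\<dots> < e / 2 + e / 2"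
      proof (rule add_less_le_mono)
        have "(\<Sum>k<n. norm (f (v k) - f (u k))) < e / (2 * M)"
          using uv by (intro d(2)[rule_format]) (simp add: d'_def)
        then show "M * (\<Sum>k<n. norm (f (v k) - f (u k))) < e / 2"
          using M by (simp add: field_simps)
        have "B * L * (\<Sum>k<n. v k - u k) \<le> B * L * (e / (2 * (B * L + 1)))"
          using uv B L by (intro mult_left_mono) (auto simp: d'_def)
        also have "\<dots> \<le> e / 2"
          using BL e by (simp add: field_simps)
        finally show "B * L * (\<Sum>k<n. v k - u k) \<le> e / 2" .
      qed
      finally show "(\<Sum>k<n. norm (f (v k) * g (v k) - f (u k) * g (u k))) < e" by simp
    qed
  qed
qed

text \<open>A degenerate interval has empty interior even if it lies inside the other one; hence the
  strict inequalities.\<close>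
lemma interval_interiors_disjointD:
  fixes u v u' v' :: real
  assumes "interior {u..v} \<inter> interior {u'..v'} = {}" "u < v" "u' < v'"
  shows "v \<le> u' \<or> v' \<le> u"
proof (rule ccontr)
  assume "\<not> ?thesis"
  then have "max u u' < min v v'" using assms by auto
  then obtain x where "max u u' < x" "x < min v v'" using dense by blast
  then show False using assms(1) by auto
qed

text \<open>A fine tagged division is split by its tags. Tags outside \<open>N\<close> are handled
  by differentiability, with error e/2 times the length. The gauge confines the intervals with tags
  in \<open>N\<close> to an open set of measure below \<delta>, and absolute continuity bounds their
  total increment. Integrability of \<open>f'\<close> is part of the conclusion.\<close>

lemma fundamental_theorem_of_calculus_abs_continuous:
  fixes f :: "real \<Rightarrow> 'a::banach"
  assumes ab: "a \<le> b" and ac: "abs_continuous_on a b f" and N: "negligible N"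
    and deriv: "\<And>x. x \<in> {a..b} - N \<Longrightarrow> (f has_vector_derivative f' x) (at x within {a..b})"
  shows "(f' has_integral (f b - f a)) {a..b}"
proof (cases "a = b")
  case True
  then show ?thesis using has_integral_refl(2)[of f' b] by simp
next
  case False
  with ab have ab': "a < b" by simp
  \<comment> \<open>With the value 0 on \<open>N\<close>, a tag there contributes nothing to the
    Riemann sum, and only the increment of \<open>f\<close> remains to be estimated.\<close>
  define g where "g x = (if x \<in> N then 0 else f' x)" for x
  have "(g has_integral (f b - f a)) {a..b}"
    unfolding has_integral_factor_content_real
  proof (intro allI impI)
    fix e :: real
    assume e: "e > 0"
    have "\<exists>d>0. \<forall>y\<in>{a..b}. norm (y-x) < d \<longrightarrow>
            norm (f y - f x - (y-x) *\<^sub>R f' x) \<le> e/2 * norm (y-x)" if "x \<in> {a..b} - N" for x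
      using deriv[OF that] half_gt_zero[OF e]
      unfolding has_vector_derivative_def has_derivative_within_alt by blast
    then have "\<forall>x. \<exists>d>0. x \<in> {a..b} - N \<longrightarrow> (\<forall>y\<in>{a..b}. norm (y-x) < d \<longrightarrow>
            norm (f y - f x - (y-x) *\<^sub>R f' x) \<le> e/2 * norm (y-x))"
      by (meson zero_less_one)
    from choice[OF this] obtain d where d: "\<And>x. 0 < d x"
       "\<And>x y. \<lbrakk>x \<in> {a..b} - N; y \<in> {a..b}; norm (y-x) < d x\<rbrakk>
                        \<Longrightarrow> norm (f y - f x - (y-x) *\<^sub>R f' x) \<le> e/2 * norm (y-x)"
      by blast
    have "e / 2 * (b - a) > 0" using e ab' by simp
    then obtain \<delta> where \<delta>: "\<delta> > 0" and ac\<delta>: "\<forall>I u v. finite (I :: (real \<times> real set) set) \<and>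
        (\<forall>i\<in>I. a \<le> u i \<and> u i \<le> v i \<and> v i \<le> b) \<and>
        (\<forall>i\<in>I. \<forall>j\<in>I. i \<noteq> j \<longrightarrow> v i \<le> u j \<or> v j \<le> u i) \<and>
        (\<Sum>i\<in>I. v i - u i) < \<delta> \<longrightarrow> (\<Sum>i\<in>I. norm (f (v i) - f (u i))) < e / 2 * (b - a)"
      by (rule abs_continuous_on_finite_family[OF ac])
    obtain U where U: "open U" "N \<subseteq> U" "U - N \<in> lmeasurable"
      "emeasure lebesgue (U - N) < ennreal \<delta>"
      using sets_lebesgue_outer_open[OF negligible_imp_sets[OF N] \<delta>] by metis
    have NU: "N \<in> lmeasurable" "measure lebesgue N = 0"
      using N negligible_iff_measure by blast+
    have "U \<in> lmeasurable"
      using fmeasurable.Un[OF U(3) NU(1)] U(2) by (simp add: Un_absorb2)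
    have mU: "measure lebesgue U < \<delta>"
    proof -
      have "measure lebesgue U \<le> measure lebesgue (U - N) + measure lebesgue N"
        using measure_Un_le[of "U - N" lebesgue N] U(2,3) NU(1) by (simp add: Un_absorb2 fmeasurableD)
      also have "\<dots> < \<delta>"
        using U(3,4) NU(2) \<delta> by (simp add: emeasure_eq_measure2 ennreal_less_iff)
      finally show ?thesis .
    qed
    define \<gamma> where "\<gamma> x = (if x \<in> N then U else ball x (d x))" for x
    have "gauge \<gamma>"
      unfolding gauge_def \<gamma>_def using U d(1) by auto
    moreover have "norm ((\<Sum>(x, K)\<in>p. measure lborel K *\<^sub>R g x) - (f b - f a)) \<le> e * measure lborel {a..b}"
      if p: "p tagged_division_of {a..b}" and fine: "\<gamma> fine p" for p
    proof -
      have pfin: "finite p" using p by blast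
      have pK: "\<exists>u v. K = {u..v} \<and> u \<le> v \<and> x \<in> K \<and> K \<subseteq> {a..b}" if xK: "(x, K) \<in> p" for x K
      proof -
        obtain u v where "K = cbox u v" "x \<in> K" "K \<subseteq> {a..b}"
          using tagged_division_ofD(2-4)[OF p xK] by metis
        then show ?thesis by (intro exI[of _ u] exI[of _ v]) auto
      qed
      have fsum: "f b - f a = (\<Sum>(x,K)\<in>p. f (Sup K) - f (Inf K))"
        using additive_tagged_division_1[OF ab p, of f] by simp
      have bsum: "b - a = (\<Sum>(x,K)\<in>p. Sup K - Inf K)"
        using additive_tagged_division_1[OF ab p, of "\<lambda>x. x"] by simp
      let ?h = "\<lambda>(x,K). measure lborel K *\<^sub>R g x - (f (Sup K) - f (Inf K))"
      define q where "q = {(x,K) \<in> p. x \<in> N}"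
      \<comment> \<open>Degenerate intervals contribute 0, and only for the others do disjoint
        interiors order the endpoints as absolute continuity demands.\<close>
      define q' where "q' = {(x,K) \<in> q. Inf K < Sup K}"
      have qp: "q \<subseteq> p" and q'q: "q' \<subseteq> q" by (auto simp: q_def q'_def)
      have "finite q'" using finite_subset[OF subset_trans[OF q'q qp] pfin] .
      have good: "norm (sum ?h (p - q)) \<le> e / 2 * (b - a)"
      proof -
        have "norm (sum ?h (p - q)) \<le> (\<Sum>(x,K)\<in>p - q. e / 2 * (Sup K - Inf K))"
        proof (rule sum_norm_le, clarify)
          fix x K
          assume xK: "(x, K) \<in> p" "(x, K) \<notin> q"
          then have xN: "x \<notin> N" by (auto simp: q_def)
          obtain u v where K: "K = {u..v}" "u \<le> v" "x \<in> K" "K \<subseteq> {a..b}" using pK[OF xK(1)] by blast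
          have "K \<subseteq> ball x (d x)" using fineD[OF fine xK(1)] xN by (simp add: \<gamma>_def)
          moreover have "u \<in> K" "v \<in> K" using K by auto
          ultimately have uv: "norm (u - x) < d x" "norm (v - x) < d x"
            by (auto simp: dist_norm norm_minus_commute)
          \<comment> \<open>The increment is split at the tag \<open>x\<close>, which lies between
            \<open>u\<close> and \<open>v\<close>; the two errors are proportional to x - u and v -
            x, which add up to the length.\<close>
          have "norm ((v - u) *\<^sub>R f' x - (f v - f u))
            = norm (f u - f x - (u - x) *\<^sub>R f' x - (f v - f x - (v - x) *\<^sub>R f' x))"
            by (auto simp: algebra_simps)
          also have "\<dots> \<le> norm (f u - f x - (u - x) *\<^sub>R f' x) + norm (f v - f x - (v - x) *\<^sub>R f' x)"
            by (rule norm_triangle_ineq4)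
          also have "\<dots> \<le> e/2 * norm (u - x) + e/2 * norm (v - x)"
            using K uv xN by (intro add_mono d(2)) auto
          also have "\<dots> = e/2 * (v - u)" using K by (auto simp: field_simps)
          finally show "norm (measure lborel K *\<^sub>R g x - (f (Sup K) - f (Inf K))) \<le> e/2 * (Sup K - Inf K)"
            using K xN by (simp add: g_def)
        qed
        also have "\<dots> \<le> (\<Sum>(x,K)\<in>p. e / 2 * (Sup K - Inf K))"
        proof (rule sum_mono2[OF pfin])
          fix xK assume "xK \<in> p - (p - q)"
          then have "xK \<in> p" by blast
          then show "0 \<le> (case xK of (x, K) \<Rightarrow> e / 2 * (Sup K - Inf K))"
            using pK[of "fst xK" "snd xK"] e by (cases xK) auto
        qed blast
        also have "\<dots> = e / 2 * (b - a)"
          by (simp add: bsum sum_distrib_left case_prod_unfold)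
        finally show ?thesis .
      qed
      have bad: "norm (sum ?h q) \<le> e / 2 * (b - a)"
      proof -
        have "sum ?h q = sum ?h q'"
        proof (rule sum.mono_neutral_right)
          show "\<forall>i\<in>q - q'. ?h i = 0"
          proof clarify
            fix x K
            assume xK: "(x, K) \<in> q" "(x, K) \<notin> q'"
            obtain u v where K: "K = {u..v}" "u \<le> v" using pK qp xK(1) by blast
            with xK have "u = v" by (auto simp: q'_def)
            with K show "measure lborel K *\<^sub>R g x - (f (Sup K) - f (Inf K)) = 0" by simp
          qed
        qed (use pfin qp q'q finite_subset in auto)
        also have "norm \<dots> \<le> (\<Sum>i\<in>q'. norm (f (Sup (snd i)) - f (Inf (snd i))))"
          by (rule sum_norm_le) (auto simp: q'_def q_def g_def norm_minus_commute)
        also have "\<dots> < e / 2 * (b - a)"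
        proof (rule ac\<delta>[rule_format], intro conjI ballI impI)
          show "finite q'" by fact
          show "a \<le> Inf (snd i)" "Inf (snd i) \<le> Sup (snd i)" "Sup (snd i) \<le> b" if "i \<in> q'" for i
          proof -
            have "(fst i, snd i) \<in> p" using that qp q'q by auto
            from pK[OF this] show "a \<le> Inf (snd i)" "Inf (snd i) \<le> Sup (snd i)" "Sup (snd i) \<le> b"
              by auto
          qed
          show disj: "Sup (snd i) \<le> Inf (snd j) \<or> Sup (snd j) \<le> Inf (snd i)"
            if ij: "i \<in> q'" "j \<in> q'" "i \<noteq> j" for i j
          proof -
            obtain u v where K: "snd i = {u..v}" "u \<le> v"
              using pK[of "fst i" "snd i"] ij qp q'q by auto
            obtain u' v' where K': "snd j = {u'..v'}" "u' \<le> v'"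
              using pK[of "fst j" "snd j"] ij qp q'q by auto
            have "interior (snd i) \<inter> interior (snd j) = {}"
              using tagged_division_ofD(5)[OF p, of "fst i" "snd i" "fst j" "snd j"] ij qp q'q by auto
            moreover have "u < v" "u' < v'" using ij K K' by (auto simp: q'_def)
            ultimately show ?thesis
              using interval_interiors_disjointD[of u v u' v'] K K' by auto
          qed
          have "(\<Sum>i\<in>q'. Sup (snd i) - Inf (snd i)) = (\<Sum>i\<in>q'. measure lebesgue (snd i))"
          proof (rule sum.cong)
            fix i assume "i \<in> q'"
            then obtain u v where "snd i = {u..v}" "u \<le> v"
              using pK[of "fst i" "snd i"] qp q'q by auto
            then show "Sup (snd i) - Inf (snd i) = measure lebesgue (snd i)" by simp
          qed simp
          \<comment> \<open>The intervals overlap in null sets only, so their total length is the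
            measure of their union, which lies in \<open>U\<close>.\<close>
          also have "\<dots> = measure lebesgue (\<Union>(snd ` q'))"
          proof (rule measure_negligible_finite_Union_image[symmetric])
            show "finite q'" by fact
            show "snd i \<in> lmeasurable" if i: "i \<in> q'" for i
            proof -
              have "(fst i, snd i) \<in> p" using i qp q'q by auto
              from pK[OF this] obtain u v where "snd i = cbox u v" by auto
              then show ?thesis by (simp only: lmeasurable_cbox)
            qed
            show "pairwise (\<lambda>i j. negligible (snd i \<inter> snd j)) q'"
            proof (rule pairwiseI)
              fix i j assume ij: "i \<in> q'" "j \<in> q'" "i \<noteq> j"
              obtain u v where K: "snd i = {u..v}" "u \<le> v"
                using pK[of "fst i" "snd i"] ij qp q'q by auto
              obtain u' v' where K': "snd j = {u'..v'}" "u' \<le> v'"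
                using pK[of "fst j" "snd j"] ij qp q'q by auto
              have "snd i \<inter> snd j \<subseteq> {u, v}"
                using disj[OF ij] K K' by auto
              then show "negligible (snd i \<inter> snd j)"
                using negligible_subset[OF negligible_finite[of "{u,v}"]] by auto
            qed
          qed
          also have "\<dots> \<le> measure lebesgue U"
          proof (rule measure_mono_fmeasurable)
            show "\<Union>(snd ` q') \<subseteq> U"
            proof (rule UN_least)
              fix i assume "i \<in> q'"
              then have "(fst i, snd i) \<in> p" "fst i \<in> N" by (auto simp: q'_def q_def)
              then show "snd i \<subseteq> U"
                using fineD[OF fine, of "fst i" "snd i"] by (simp add: \<gamma>_def)
            qed
            show "\<Union>(snd ` q') \<in> sets lebesgue"
            proof (rule sets.finite_Union)
              show "finite (snd ` q')" using \<open>finite q'\<close> by simp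
              show "snd ` q' \<subseteq> sets lebesgue"
              proof clarify
                fix x K assume "(x, K) \<in> q'"
                then have "(x, K) \<in> p" using qp q'q by blast
                from pK[OF this] show "snd (x, K) \<in> sets lebesgue" by auto
              qed
            qed
          qed fact
          also note mU
          finally show "(\<Sum>i\<in>q'. Sup (snd i) - Inf (snd i)) < \<delta>" .
        qed
        finally show ?thesis by simp
      qed
      have "(\<Sum>(x, K)\<in>p. measure lborel K *\<^sub>R g x) - (f b - f a) = sum ?h p"
        by (simp add: fsum sum_subtractf case_prod_unfold)
      also have "\<dots> = sum ?h (p - q) + sum ?h q"
        using sum.subset_diff[OF qp pfin] by blast
      also have "norm \<dots> \<le> e / 2 * (b - a) + e / 2 * (b - a)"
        by (intro norm_triangle_le add_mono good bad)
      finally show ?thesis using ab by (simp add: algebra_simps)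
    qed
    ultimately show "\<exists>d. gauge d \<and> (\<forall>p. p tagged_division_of {a..b} \<and> d fine p \<longrightarrow>
        norm ((\<Sum>(x, K)\<in>p. measure lborel K *\<^sub>R g x) - (f b - f a)) \<le> e * measure lborel {a..b})"
      by (intro exI[of _ \<gamma>] conjI allI impI) simp_all
  qed
  then show ?thesis
    by (rule has_integral_spike[OF N, rotated]) (auto simp: g_def)
qed

section \<open>Rotations and radial integration in the plane\<close>

text \<open>Lebesgue measure is determined by its values on open boxes, and there both sides are a
  product of two lengths. This makes Tonelli in the coordinates Re and Im available on type
  \<open>complex\<close>.\<close>

lemma lborel_complex_eq_distr:
  "(lborel :: complex measure) = distr (lborel \<Otimes>\<^sub>M lborel) borel (\<lambda>(x, y). Complex x y)"
proof (rule lborel_eqI)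
  fix l u :: complex
  assume le: "\<And>b. b \<in> Basis \<Longrightarrow> l \<bullet> b \<le> u \<bullet> b"
  have lu: "Re l \<le> Re u" "Im l \<le> Im u"
    using le[of 1] le[of \<i>] by (auto simp: Basis_complex_def)
  have [measurable]: "(\<lambda>(x, y). Complex x y) \<in> borel_measurable (lborel \<Otimes>\<^sub>M lborel)"
    by (subst lborel_prod) (auto simp: case_prod_unfold intro!: borel_measurable_continuous_onI continuous_intros)
  have "emeasure (distr (lborel \<Otimes>\<^sub>M lborel) borel (\<lambda>(x, y). Complex x y)) (box l u)
      = emeasure (lborel \<Otimes>\<^sub>M lborel) ({Re l<..<Re u} \<times> {Im l<..<Im u})"
    by (subst emeasure_distr) (auto simp: box_def Basis_complex_def space_pair_measure
        intro!: arg_cong[where f="emeasure _"])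
  also have "\<dots> = (\<Prod>b\<in>Basis. (u - l) \<bullet> b)"
    using lu by (subst lborel.emeasure_pair_measure_Times)
      (auto simp: Basis_complex_def ennreal_mult)
  finally show "emeasure (distr (lborel \<Otimes>\<^sub>M lborel) borel (\<lambda>(x, y). Complex x y)) (box l u)
      = (\<Prod>b\<in>Basis. (u - l) \<bullet> b)" .
qed simp

lemma borel_measurable_Complex [measurable]:
  "(\<lambda>(x, y). Complex x y) \<in> borel_measurable (borel \<Otimes>\<^sub>M borel)"
  by (subst borel_prod) (auto simp: case_prod_unfold intro!: borel_measurable_continuous_onI continuous_intros)

lemma nn_integral_complex:
  assumes [measurable]: "f \<in> borel_measurable borel"
  shows "(\<integral>\<^sup>+z. f z \<partial>lborel) = (\<integral>\<^sup>+x. \<integral>\<^sup>+y. f (Complex x y) \<partial>lborel \<partial>lborel)"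
    and "(\<integral>\<^sup>+z. f z \<partial>lborel) = (\<integral>\<^sup>+y. \<integral>\<^sup>+x. f (Complex x y) \<partial>lborel \<partial>lborel)"
proof -
  have [measurable]: "(\<lambda>x. f (Complex (fst x) (snd x))) \<in> borel_measurable (borel \<Otimes>\<^sub>M borel)"
    using measurable_compose[OF borel_measurable_Complex assms] by (simp add: case_prod_unfold)
  have "(\<integral>\<^sup>+z. f z \<partial>lborel) = (\<integral>\<^sup>+(x, y). f (Complex x y) \<partial>(lborel \<Otimes>\<^sub>M lborel))"
    by (subst lborel_complex_eq_distr, subst nn_integral_distr) (auto simp: case_prod_unfold)
  then show *: "(\<integral>\<^sup>+z. f z \<partial>lborel) = (\<integral>\<^sup>+x. \<integral>\<^sup>+y. f (Complex x y) \<partial>lborel \<partial>lborel)"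
    by (simp add: case_prod_unfold lborel.nn_integral_fst[symmetric])
  also have "\<dots> = (\<integral>\<^sup>+y. \<integral>\<^sup>+x. f (Complex x y) \<partial>lborel \<partial>lborel)"
    by (rule lborel_pair.Fubini') (simp add: case_prod_unfold)
  finally show "(\<integral>\<^sup>+z. f z \<partial>lborel) = (\<integral>\<^sup>+y. \<integral>\<^sup>+x. f (Complex x y) \<partial>lborel \<partial>lborel)" .
qed

text \<open>With one coordinate fixed, a shear is a translation in the other; Tonelli reduces the
  claim to translation invariance on the line.\<close>

lemma nn_integral_complex_shear:
  assumes [measurable]: "f \<in> borel_measurable borel"
  shows "(\<integral>\<^sup>+z. f (z + of_real (a * Im z)) \<partial>lborel) = (\<integral>\<^sup>+z. f z \<partial>lborel)"
    and "(\<integral>\<^sup>+z. f (z + \<i> * of_real (a * Re z)) \<partial>lborel) = (\<integral>\<^sup>+z. f z \<partial>lborel)"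
proof -
  have [measurable]: "(\<lambda>x. f (Complex x y)) \<in> borel_measurable borel"
      "(\<lambda>x. f (Complex y x)) \<in> borel_measurable borel" for y
    using measurable_compose[OF borel_measurable_Complex assms] by measurable
  have "(\<integral>\<^sup>+z. f (z + of_real (a * Im z)) \<partial>lborel)
      = (\<integral>\<^sup>+y. \<integral>\<^sup>+x. f (Complex (a * y + 1 * x) y) \<partial>lborel \<partial>lborel)"
    by (subst nn_integral_complex(2)) (auto simp: complex_eq_iff intro!: nn_integral_cong arg_cong[where f=f])
  also have "\<dots> = (\<integral>\<^sup>+y. \<integral>\<^sup>+x. f (Complex x y) \<partial>lborel \<partial>lborel)"
  proof (rule nn_integral_cong)
    fix y
    show "(\<integral>\<^sup>+x. f (Complex (a * y + 1 * x) y) \<partial>lborel) = (\<integral>\<^sup>+x. f (Complex x y) \<partial>lborel)"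
      using nn_integral_real_affine[of "\<lambda>x. f (Complex x y)" 1 "a * y"] by simp
  qed
  finally show "(\<integral>\<^sup>+z. f (z + of_real (a * Im z)) \<partial>lborel) = (\<integral>\<^sup>+z. f z \<partial>lborel)"
    by (simp add: nn_integral_complex(2))
  have "(\<integral>\<^sup>+z. f (z + \<i> * of_real (a * Re z)) \<partial>lborel)
      = (\<integral>\<^sup>+x. \<integral>\<^sup>+y. f (Complex x (a * x + 1 * y)) \<partial>lborel \<partial>lborel)"
    by (subst nn_integral_complex(1)) (auto simp: complex_eq_iff intro!: nn_integral_cong arg_cong[where f=f])
  also have "\<dots> = (\<integral>\<^sup>+x. \<integral>\<^sup>+y. f (Complex x y) \<partial>lborel \<partial>lborel)"
  proof (rule nn_integral_cong)
    fix x
    show "(\<integral>\<^sup>+y. f (Complex x (a * x + 1 * y)) \<partial>lborel) = (\<integral>\<^sup>+y. f (Complex x y) \<partial>lborel)"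
      using nn_integral_real_affine[of "\<lambda>y. f (Complex x y)" 1 "a * x"] by simp
  qed
  finally show "(\<integral>\<^sup>+z. f (z + \<i> * of_real (a * Re z)) \<partial>lborel) = (\<integral>\<^sup>+z. f z \<partial>lborel)"
    by (simp add: nn_integral_complex(1))
qed

text \<open>A rotation that is not \<open>\<plusminus>1\<close> is a product of three shears.\<close>
lemma nn_integral_complex_rotate:
  fixes c :: complex and f :: "complex \<Rightarrow> ennreal"
  assumes c: "norm c = 1" and [measurable]: "f \<in> borel_measurable borel"
  shows "(\<integral>\<^sup>+z. f (c * z) \<partial>lborel) = (\<integral>\<^sup>+z. f z \<partial>lborel)"
proof -
  have *: "(\<integral>\<^sup>+z. g (c * z) \<partial>lborel) = (\<integral>\<^sup>+z. g z \<partial>lborel)"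
    if c: "norm c = 1" "Im c \<noteq> 0" and [measurable]: "g \<in> borel_measurable borel"
    for c :: complex and g :: "complex \<Rightarrow> ennreal"
  proof -
    \<comment> \<open>For c = cis \<phi> these are a = -tan(\<phi>/2) and b = sin \<phi>, so that
      \<open>X\<close>, \<open>Y\<close>, \<open>X\<close> compose to the rotation by
      \<phi>.\<close>
    define a b where "a = (Re c - 1) / Im c" and "b = Im c"
    define X where "X z = z + of_real (a * Im z)" for z
    define Y where "Y z = z + \<i> * of_real (b * Re z)" for z
    have [measurable]: "X \<in> borel_measurable borel" "Y \<in> borel_measurable borel"
      unfolding X_def Y_def by measurable
    have norm_c: "(Re c)\<^sup>2 + (Im c)\<^sup>2 = 1"
      using c(1) cmod_power2[of c] by simp
    have ab: "a * b = Re c - 1" using c(2) by (simp add: a_def b_def)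
    have a2: "a * (Re c + 1) = - b"
      using c(2) norm_c by (simp add: a_def b_def field_simps power2_eq_square)
    have a2': "a * (2 + a * b) = - b"
      using a2 ab by (simp add: add.commute)
    have "c * z = X (Y (X z))" for z
    proof (rule complex_eqI)
      have "Re (X (Y (X z))) = (1 + a * b) * Re z + (a * (2 + a * b)) * Im z"
        by (simp add: X_def Y_def algebra_simps)
      also have "\<dots> = Re c * Re z - Im c * Im z"
        by (subst a2', subst ab) (simp add: b_def)
      finally show "Re (c * z) = Re (X (Y (X z)))" by simp
      have "Im (X (Y (X z))) = b * Re z + (1 + a * b) * Im z"
        by (simp add: X_def Y_def algebra_simps)
      also have "1 + a * b = Re c"
        by (simp add: ab)
      finally show "Im (c * z) = Im (X (Y (X z)))"
        by (simp add: b_def)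
    qed
    then have "(\<integral>\<^sup>+z. g (c * z) \<partial>lborel) = (\<integral>\<^sup>+z. g (X (Y (X z))) \<partial>lborel)" by simp
    also have "\<dots> = (\<integral>\<^sup>+z. g (X (Y z)) \<partial>lborel)"
      using nn_integral_complex_shear(1)[of "\<lambda>z. g (X (Y z))" a] by (simp add: X_def)
    also have "\<dots> = (\<integral>\<^sup>+z. g (X z) \<partial>lborel)"
      using nn_integral_complex_shear(2)[of "\<lambda>z. g (X z)" b] by (simp add: Y_def)
    also have "\<dots> = (\<integral>\<^sup>+z. g z \<partial>lborel)"
      using nn_integral_complex_shear(1)[of g a] by (simp add: X_def)
    finally show ?thesis .
  qed
  consider "Im c \<noteq> 0" | "c = 1" | "c = -1"
    using c by (cases "Im c = 0") (auto simp: cmod_def complex_eq_iff power2_eq_1_iff abs_if split: if_splits)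
  then show ?thesis
  proof cases
    case 1
    then show ?thesis using * c by simp
  next
    case 3
    \<comment> \<open>The half-turn has Im c = 0, where the shear parameter \<open>a\<close> breaks
      down; it is two quarter-turns.\<close>
    have "(\<integral>\<^sup>+z. f (c * z) \<partial>lborel) = (\<integral>\<^sup>+z. f (\<i> * (\<i> * z)) \<partial>lborel)"
      by (simp add: 3 flip: mult.assoc)
    also have "\<dots> = (\<integral>\<^sup>+z. f (\<i> * z) \<partial>lborel)"
      using *[of \<i> "\<lambda>z. f (\<i> * z)"] by simp
    also have "\<dots> = (\<integral>\<^sup>+z. f z \<partial>lborel)"
      using *[of \<i> f] by simp
    finally show ?thesis .
  qed simp
qed

section \<open>Radial integration over the unit disc\<close>

lemma borel_measurable_indicator_ball [measurable]:
  "(indicator (ball a r) :: 'a::metric_space \<Rightarrow> ennreal) \<in> borel_measurable borel"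
  by (rule borel_measurable_indicator) simp

text \<open>Finite measures on the line are compared on the rays {x<..}: both give the area pi (1 -
  x^2) of an annulus, on the left from the area of discs, on the right by integrating 2 pi r. This
  takes the place of polar coordinates.\<close>

lemma distr_norm_complex_disc:
  "distr (density lborel (indicator (ball 0 1))) borel (norm :: complex \<Rightarrow> real)
    = density lborel (\<lambda>r. ennreal (2 * pi * r) * indicator {0<..<1} r)" (is "?M = ?N")
proof (rule measure_eqI_lessThan)
  have ball: "emeasure lborel (ball (0::complex) r) = ennreal (pi * r\<^sup>2)"
    and cball: "emeasure lborel (cball (0::complex) r) = ennreal (pi * r\<^sup>2)" if "r \<ge> 0" for r
    using that by (simp_all add: emeasure_ball emeasure_cball unit_ball_vol_2)
  \<comment> \<open>Clamping \<open>x\<close> to [0, 1] lets one formula cover the whole disc (x <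
    0), an annulus, and the empty set (x >= 1).\<close>
  have M: "emeasure ?M {x<..} = ennreal (pi * (1 - (max 0 (min 1 x))\<^sup>2))" for x
  proof -
    have "emeasure ?M {x<..} = (\<integral>\<^sup>+z. indicator (ball 0 1) z * indicator (norm -` {x<..}) (z::complex) \<partial>lborel)"
      by (subst emeasure_distr, simp, simp, subst emeasure_density)
        (auto simp: measurable_sets_borel[where M=borel])
    also have "\<dots> = (\<integral>\<^sup>+z. indicator (ball 0 1 \<inter> (norm -` {x<..})) (z::complex) \<partial>lborel)"
      by (intro nn_integral_cong) (auto split: split_indicator)
    also have "\<dots> = emeasure lborel (ball 0 1 \<inter> (norm -` {x<..} :: complex set))"
      by (rule nn_integral_indicator) (auto intro!: sets.Int simp: measurable_sets_borel[where M=borel])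
    also have "\<dots> = ennreal (pi * (1 - (max 0 (min 1 x))\<^sup>2))"
    proof -
      consider "x < 0" | "0 \<le> x" "x < 1" | "1 \<le> x" by linarith
      then show ?thesis
      proof cases
        case 1
        then have "ball 0 1 \<inter> (norm -` {x<..} :: complex set) = ball 0 1"
          by (auto intro: less_le_trans[OF _ norm_ge_zero])
        then show ?thesis using ball[of 1] 1 by (simp add: max_def min_def)
      next
        case 2
        have "ball 0 1 \<inter> (norm -` {x<..} :: complex set) = ball 0 1 - cball 0 x"
          by auto
        also have "emeasure lborel \<dots> = ennreal (pi * 1\<^sup>2) - ennreal (pi * x\<^sup>2)"
          using 2 by (subst emeasure_Diff) (auto simp: ball cball)
        also have "\<dots> = ennreal (pi * (1 - x\<^sup>2))"
          by (subst ennreal_minus) (auto simp: algebra_simps)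
        finally show ?thesis using 2 by (simp add: max_def min_def)
      next
        case 3
        then have "ball 0 1 \<inter> (norm -` {x<..} :: complex set) = {}" by auto
        then show ?thesis using 3 by (simp add: max_def min_def)
      qed
    qed
    finally show ?thesis .
  qed
  show "emeasure ?M {x<..} < \<infinity>" for x unfolding M by simp
  show "emeasure ?M {x<..} = emeasure ?N {x<..}" for x
  proof -
    define m where "m = max 0 (min 1 x)"
    have m: "0 \<le> m" "m \<le> 1" by (auto simp: m_def)
    have "((\<lambda>r. 2 * pi * r) has_integral (pi * 1\<^sup>2 - pi * m\<^sup>2)) {m..1}"
      using m by (intro fundamental_theorem_of_calculus)
        (auto intro!: derivative_eq_intros simp flip: has_real_derivative_iff_has_vector_derivative)
    then have "ennreal (pi * 1\<^sup>2 - pi * m\<^sup>2) = (\<integral>\<^sup>+r. ennreal (2 * pi * r) * indicator {m..1} r \<partial>lborel)"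
      using m by (subst nn_integral_has_integral_lebesgue'[symmetric]) auto
    also have "\<dots> = (\<integral>\<^sup>+r. ennreal (2 * pi * r) * indicator {0<..<1} r * indicator {x<..} r \<partial>lborel)"
      using AE_lborel_singleton[of m] AE_lborel_singleton[of 1]
      by (intro nn_integral_cong_AE, eventually_elim) (auto simp: m_def split: split_indicator)
    also have "\<dots> = emeasure ?N {x<..}"
      by (subst emeasure_density) auto
    finally show ?thesis by (simp add: M m_def algebra_simps)
  qed
qed auto

lemma nn_integral_disc_radial:
  assumes [measurable]: "f \<in> borel_measurable borel"
  shows "(\<integral>\<^sup>+z\<in>ball (0::complex) 1. f (norm z) \<partial>lborel)
    = ennreal (2 * pi) * (\<integral>\<^sup>+r\<in>{0<..<1}. f r * ennreal r \<partial>lborel)"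
proof -
  have "(\<integral>\<^sup>+z\<in>ball (0::complex) 1. f (norm z) \<partial>lborel)
      = (\<integral>\<^sup>+r. f r \<partial>distr (density lborel (indicator (ball 0 1))) borel (norm :: complex \<Rightarrow> real))"
    by (subst nn_integral_distr, simp, simp, subst nn_integral_density) (auto simp: mult.commute)
  also have "\<dots> = (\<integral>\<^sup>+r. ennreal (2 * pi * r) * indicator {0<..<1} r * f r \<partial>lborel)"
    by (simp add: distr_norm_complex_disc nn_integral_density)
  also have "\<dots> = (\<integral>\<^sup>+r. ennreal (2 * pi) * (f r * ennreal r * indicator {0<..<1} r) \<partial>lborel)"
    by (intro nn_integral_cong) (auto simp: ennreal_mult mult_ac split: split_indicator)
  also have "\<dots> = ennreal (2 * pi) * (\<integral>\<^sup>+r\<in>{0<..<1}. f r * ennreal r \<partial>lborel)"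
    by (rule nn_integral_cmult) measurable
  finally show ?thesis .
qed

text \<open>Rotating by \<open>cis s\<close> moves the boundary point 1 to \<open>cis s\<close>, so
  the integral over the disc is a constant \<open>J\<close>. Integrating \<open>J\<close> over the
  circle produces 2 pi \<open>J\<close>; after Tonelli, radial integration of the slice bound puts
  the same factor 2 pi on the other side, and it cancels. The origin is a null set.\<close>

lemma nn_integral_disc_rotation_invariant_le:
  fixes H :: "complex \<Rightarrow> complex \<Rightarrow> ennreal"
  assumes [measurable]: "case_prod H \<in> borel_measurable (borel \<Otimes>\<^sub>M borel)" "h \<in> borel_measurable borel"
    and inv: "\<And>c z \<zeta>. norm c = 1 \<Longrightarrow> H (c * z) (c * \<zeta>) = H z \<zeta>"
    and slice: "\<And>z. z \<in> ball 0 1 \<Longrightarrow> z \<noteq> 0 \<Longrightarrow> (\<integral>\<^sup>+t\<in>{0..2*pi}. H z (cis t) \<partial>lborel) \<le> h (norm z)"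
  shows "(\<integral>\<^sup>+z\<in>ball 0 1. H z (cis s) \<partial>lborel) \<le> (\<integral>\<^sup>+r\<in>{0<..<1}. h r * ennreal r \<partial>lborel)"
proof -
  have [measurable]: "cis \<in> borel_measurable borel"
    by (auto intro!: borel_measurable_continuous_onI continuous_intros)
  define J where "J = (\<integral>\<^sup>+z\<in>ball 0 1. H z 1 \<partial>lborel)"
  have J: "(\<integral>\<^sup>+z\<in>ball 0 1. H z (cis s) \<partial>lborel) = J" for s
  proof -
    have "(\<integral>\<^sup>+z\<in>ball 0 1. H z (cis s) \<partial>lborel)
        = (\<integral>\<^sup>+z. H (cis s * z) (cis s * 1) * indicator (ball 0 1) (cis s * z) \<partial>lborel)"
      by (subst nn_integral_complex_rotate[symmetric, where c="cis s"]) auto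
    also have "\<dots> = J"
      unfolding J_def inv[OF norm_cis] by (intro nn_integral_cong) (auto simp: norm_mult split: split_indicator)
    finally show ?thesis .
  qed
  have "ennreal (2 * pi) * J = (\<integral>\<^sup>+t. J * indicator {0..2*pi} t \<partial>lborel)"
    by (subst nn_integral_cmult) (auto simp: mult.commute)
  also have "\<dots> = (\<integral>\<^sup>+t. (\<integral>\<^sup>+z. H z (cis t) * indicator (ball 0 1) z * indicator {0..2*pi} t \<partial>lborel) \<partial>lborel)"
    by (subst nn_integral_multc) (auto simp: J)
  also have "\<dots> = (\<integral>\<^sup>+z. (\<integral>\<^sup>+t. H z (cis t) * indicator (ball 0 1) z * indicator {0..2*pi} t \<partial>lborel) \<partial>lborel)"
    by (rule lborel_pair.Fubini') measurable
  also have "\<dots> \<le> (\<integral>\<^sup>+z\<in>ball (0::complex) 1. h (norm z) \<partial>lborel)"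
  proof (rule nn_integral_mono_AE)
    show "AE z in lborel. (\<integral>\<^sup>+t. H z (cis t) * indicator (ball 0 1) z * indicator {0..2*pi} t \<partial>lborel)
        \<le> h (norm z) * indicator (ball 0 1) z"
      using AE_lborel_singleton[of "0::complex"]
    proof eventually_elim
      fix z :: complex assume "z \<noteq> 0"
      then show "(\<integral>\<^sup>+t. H z (cis t) * indicator (ball 0 1) z * indicator {0..2*pi} t \<partial>lborel)
        \<le> h (norm z) * indicator (ball 0 1) z"
        using slice[of z] by (cases "z \<in> ball 0 1") auto
    qed
  qed
  also have "\<dots> = ennreal (2 * pi) * (\<integral>\<^sup>+r\<in>{0<..<1}. h r * ennreal r \<partial>lborel)"
    by (rule nn_integral_disc_radial) measurable
  finally have "J \<le> (\<integral>\<^sup>+r\<in>{0<..<1}. h r * ennreal r \<partial>lborel)"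
    by (subst (asm) ennreal_mult_le_mult_iff) auto
  then show ?thesis by (simp add: J)
qed

section \<open>Jensen's inequality and radial integrals\<close>

text \<open>Convexity is used on {0<..}; at x = 0 the claim reduces to (1 - p) c^p <= 0. In tangent
  form, Jensen's inequality follows by mere integration.\<close>

lemma powr_ge_tangent:
  fixes x c p :: real
  assumes "p \<ge> 1" "x \<ge> 0" "c > 0"
  shows "c powr p + p * c powr (p - 1) * (x - c) \<le> x powr p"
proof (cases "x = 0")
  case True
  have "c powr (p - 1) * c = c powr p"
    using assms by (simp add: powr_diff)
  then have "c powr p + p * c powr (p - 1) * (0 - c) = (1 - p) * c powr p"
    by (simp add: algebra_simps)
  also have "\<dots> \<le> 0" using assms by (simp add: mult_nonpos_nonneg)
  finally show ?thesis using True by simp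
next
  case False
  have "p * c powr (p - 1) * (x - c) \<le> x powr p - c powr p"
  proof (rule convex_on_imp_above_tangent[OF powr_convex[OF assms(1)]])
    show "((\<lambda>x. x powr p) has_real_derivative p * c powr (p - 1)) (at c within {0<..})"
      using assms by (auto intro!: derivative_eq_intros)
    show "c \<in> interior {0<..}" using assms by (simp add: interior_open)
  qed (use assms False in \<open>auto intro: convex_connected\<close>)
  then show ?thesis by simp
qed

lemma powr_half_sum_le:
  fixes x y p :: real
  assumes "p \<ge> 1" "x \<ge> 0" "y \<ge> 0"
  shows "((x + y) / 2) powr p \<le> (x powr p + y powr p) / 2"
proof (cases "x + y = 0")
  case False
  define c where "c = (x + y) / 2"
  have "c > 0" using False assms by (simp add: c_def)
  \<comment> \<open>The tangent is taken at the midpoint, where the two linear terms cancel.\<close>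
  then have "c powr p + p * c powr (p - 1) * (x - c) + (c powr p + p * c powr (p - 1) * (y - c))
      \<le> x powr p + y powr p"
    using assms by (intro add_mono powr_ge_tangent)
  also have "c powr p + p * c powr (p - 1) * (x - c) + (c powr p + p * c powr (p - 1) * (y - c))
      = 2 * c powr p + p * c powr (p - 1) * (x + y - 2 * c)"
    by (simp add: algebra_simps)
  also have "x + y - 2 * c = 0" by (simp add: c_def)
  finally show ?thesis by (simp add: c_def)
qed (use assms in simp)

text \<open>Jensen's inequality for the density K/k, where k is the mass of \<open>K\<close>: the
  tangent inequality at the weighted mean \<open>c\<close> is integrated against \<open>K\<close>,
  and the linear term vanishes. Rescaling by (k c)^p = k^(p-1) (k c^p) gives the factor in
  front.\<close>

lemma powr_integral_weighted_le:
  fixes K g :: "'a \<Rightarrow> real"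
  assumes p: "p \<ge> 1" and K: "\<And>x. x \<in> space M \<Longrightarrow> K x \<ge> 0" and g: "\<And>x. x \<in> space M \<Longrightarrow> g x \<ge> 0"
    and int: "integrable M K" "integrable M (\<lambda>x. K x * g x)" "integrable M (\<lambda>x. K x * g x powr p)"
    and pos: "(LINT x|M. K x) > 0"
  shows "(LINT x|M. K x * g x) powr p
    \<le> (LINT x|M. K x) powr (p - 1) * (LINT x|M. K x * g x powr p)"
proof -
  define k where "k = (LINT x|M. K x)"
  define c where "c = (LINT x|M. K x * g x) / k"
  have k: "k > 0" using pos by (simp add: k_def)
  have Kg: "(LINT x|M. K x * g x) = k * c" using k by (simp add: c_def)
  have "(LINT x|M. K x * g x) \<ge> 0" using K g by (intro Bochner_Integration.integral_nonneg) auto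
  then have c: "c \<ge> 0" using k by (simp add: c_def)
  have nonneg: "(LINT x|M. K x * g x powr p) \<ge> 0"
    using K by (intro Bochner_Integration.integral_nonneg) auto
  show ?thesis
  proof (cases "c = 0")
    \<comment> \<open>The tangent needs c > 0; for c = 0 the left-hand side is 0 powr p = 0.\<close>
    case True
    then show ?thesis using nonneg by (simp add: Kg)
  next
    case False
    have "(LINT x|M. A * K x + B * (K x * g x)) = A * k + B * (k * c)" for A B
      using int by (simp add: Kg k_def)
    from this[of "c powr p - p * c powr (p - 1) * c" "p * c powr (p - 1)"]
    have "k * c powr p = (LINT x|M. (c powr p - p * c powr (p - 1) * c) * K x + p * c powr (p - 1) * (K x * g x))"
      by (simp add: algebra_simps)
    also have "\<dots> \<le> (LINT x|M. K x * g x powr p)"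
    proof (rule integral_mono)
      fix x assume x: "x \<in> space M"
      have "K x * (c powr p + p * c powr (p - 1) * (g x - c)) \<le> K x * g x powr p"
        using K g x p c False by (intro mult_left_mono powr_ge_tangent) auto
      then show "(c powr p - p * c powr (p - 1) * c) * K x + p * c powr (p - 1) * (K x * g x) \<le> K x * g x powr p"
        by (simp add: algebra_simps)
    qed (use int in auto)
    finally have *: "k * c powr p \<le> (LINT x|M. K x * g x powr p)" .
    have "(k * c) powr p = k powr (p - 1) * (k * c powr p)"
      using k c by (simp add: powr_mult powr_diff)
    also have "\<dots> \<le> k powr (p - 1) * (LINT x|M. K x * g x powr p)"
      using * by (intro mult_left_mono) auto
    finally show ?thesis by (simp add: Kg k_def)
  qed
qed

text \<open>Both sides vanish at 0, and their difference has derivative ((1 - x^2)^(-1/2) - 1) / (1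
  - x^2) >= 0. After division by r the bound is regular at 0 and has a power singularity at
  1.\<close>

lemma artanh_le:
  fixes r :: real
  assumes "0 \<le> r" "r < 1"
  shows "artanh r \<le> r / sqrt (1 - r\<^sup>2)"
proof -
  have pos: "1 - x\<^sup>2 > 0" if "0 \<le> x" "x \<le> r" for x
    using that assms by (simp add: power2_less_1_iff abs_square_less_1)
  have "0 / sqrt (1 - 0\<^sup>2) - artanh 0 \<le> r / sqrt (1 - r\<^sup>2) - artanh (r :: real)"
  proof (rule DERIV_nonneg_imp_nondecreasing[OF assms(1)])
    fix x assume x: "0 \<le> x" "x \<le> r"
    define q where "q = 1 - x\<^sup>2"
    have q: "0 < q" "q \<le> 1" using pos[OF x] by (auto simp: q_def)
    have sq: "sqrt q * sqrt q = q" "sqrt q > 0" using q by auto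
    have "((\<lambda>x. sqrt (1 - x\<^sup>2)) has_real_derivative (- x / sqrt q)) (at x)"
      using q unfolding q_def by (auto intro!: derivative_eq_intros simp: field_simps)
    from DERIV_divide[OF DERIV_ident this] have
      "((\<lambda>x. x / sqrt (1 - x\<^sup>2)) has_real_derivative ((1 * sqrt q - x * (- x / sqrt q)) / (sqrt q * sqrt q))) (at x)"
      using q by (simp add: q_def)
    moreover have "(artanh has_real_derivative 1 / q) (at x)"
      using x assms artanh_real_has_field_derivative[of x UNIV] by (simp add: q_def)
    ultimately have "((\<lambda>x. x / sqrt (1 - x\<^sup>2) - artanh x) has_real_derivative
        ((1 * sqrt q - x * (- x / sqrt q)) / (sqrt q * sqrt q) - 1 / q)) (at x)"
      by (rule DERIV_diff)
    also have "1 * sqrt q - x * (- x / sqrt q) = (sqrt q * sqrt q + x\<^sup>2) / sqrt q"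
      using sq(2) by (simp add: field_simps power2_eq_square)
    also have "\<dots> / (sqrt q * sqrt q) - 1 / q = (1 / sqrt q - 1) / q"
      unfolding sq(1) by (simp add: q_def diff_divide_distrib)
    finally have "((\<lambda>x. x / sqrt (1 - x\<^sup>2) - artanh x) has_real_derivative (1 / sqrt q - 1) / q) (at x)" .
    moreover have "(1 / sqrt q - 1) / q \<ge> 0" using q by simp
    ultimately show "\<exists>y. ((\<lambda>x. x / sqrt (1 - x\<^sup>2) - artanh x) has_real_derivative y) (at x) \<and> 0 \<le> y"
      by blast
  qed
  then show ?thesis by simp
qed

lemma artanh_pos:
  fixes r :: real
  assumes "0 < r" "r < 1"
  shows "artanh r > 0"
  using assms by (simp add: artanh_def)

lemma borel_measurable_artanh [measurable]: "(artanh :: real \<Rightarrow> real) \<in> borel_measurable borel"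
  unfolding artanh_def[abs_def] by measurable

text \<open>Since artanh r / r <= (1 - r)^(-1/2), the integrand is dominated by (4/pi)^p (1 -
  r)^(-p/2), and p/2 < 1. The Bochner integral defaults to 0 on non-integrable functions;
  integrability is what identifies \<open>C_const p\<close> with the nonnegative integral that the
  estimate produces.\<close>

lemma set_integrable_C_const:
  assumes p: "1 \<le> p" "p < 2"
  shows "set_integrable lborel {0<..<1} (\<lambda>r. ((4 * artanh r) / (pi * r)) powr p * r)"
proof -
  have "((\<lambda>x. x powr (-p/2)) has_integral (1 powr (-p/2 + 1) / (-p/2 + 1))) {0..1}"
    using p by (intro has_integral_powr_from_0) auto
  then have "((\<lambda>x. (-1 * x + 1) powr (-p/2)) has_integral (1 powr (-p/2 + 1) / (-p/2 + 1))) ((\<lambda>x. 1 - x) ` {0..1})"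
    using has_integral_affinity[of "\<lambda>x. x powr (-p/2)" _ 0 1 "-1" 1] by simp
  moreover have "(\<lambda>x. 1 - x) ` {0..1} = {0..1::real}"
    by (auto simp: image_iff intro!: bexI[of _ "1 - _"])
  ultimately have "(\<lambda>x. (1 - x) powr (-p/2)) integrable_on {0..1}" by auto
  then have "(\<lambda>x. (1 - x) powr (-p/2)) absolutely_integrable_on {0..1}"
    by (intro nonnegative_absolutely_integrable_1) auto
  then have "set_integrable lborel {0..1} (\<lambda>x. (1 - x) powr (-p/2))"
    unfolding set_integrable_def by (subst (asm) integrable_completion) auto
  then have "set_integrable lborel {0<..<1} (\<lambda>x. (4/pi) powr p * (1 - x) powr (-p/2))"
    by (intro set_integrable_mult_right, elim set_integrable_subset) auto
  then show ?thesis
  proof (rule set_integrable_bound)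
    show "set_borel_measurable lborel {0<..<1} (\<lambda>r. ((4 * artanh r) / (pi * r)) powr p * r)"
      unfolding set_borel_measurable_def by measurable
    show "AE r in lborel. r \<in> {0<..<1} \<longrightarrow> norm (((4 * artanh r) / (pi * r)) powr p * r)
        \<le> norm ((4/pi) powr p * (1 - r) powr (-p/2))"
    proof (intro AE_I2 impI)
      fix r :: real assume r: "r \<in> {0<..<1}"
      have "artanh r / r \<le> 1 / sqrt (1 - r\<^sup>2)"
        using artanh_le[of r] r by (simp add: field_simps)
      also have "\<dots> \<le> 1 / sqrt (1 - r)"
        using r mult_left_le[of r r] mult_strict_mono[of r 1 r 1]
        by (intro divide_left_mono) (auto simp: power2_eq_square)
      also have "\<dots> = (1 - r) powr (-1/2)"
        using r by (simp add: powr_minus powr_half_sqrt field_simps)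
      finally have "(4 / pi * (artanh r / r)) powr p \<le> (4 / pi * (1 - r) powr (-1/2)) powr p"
        using r p artanh_pos[of r] by (intro powr_mono2 mult_left_mono) auto
      also have "\<dots> = (4/pi) powr p * (1 - r) powr (-p/2)"
        using r by (subst powr_mult) (auto simp: powr_powr)
      finally have "((4 * artanh r) / (pi * r)) powr p \<le> (4/pi) powr p * (1 - r) powr (-p/2)"
        by simp
      moreover have "((4 * artanh r) / (pi * r)) powr p * r \<le> ((4 * artanh r) / (pi * r)) powr p"
        using r by (intro mult_left_le) auto
      ultimately show "norm (((4 * artanh r) / (pi * r)) powr p * r)
        \<le> norm ((4/pi) powr p * (1 - r) powr (-p/2))"
        using r by simp
    qed
  qed
qed

text \<open>The integrand is r^(1-p), with exponent above -1 because p < 2. This is the share of the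
  Poisson kernel in the final constant.\<close>

lemma nn_integral_powr_unit_interval:
  assumes p: "1 \<le> p" "p < 2"
  shows "(\<integral>\<^sup>+r\<in>{0<..<1}. ennreal (r powr (-p)) * ennreal r \<partial>lborel) = ennreal (1 / (2 - p))"
proof -
  have "((\<lambda>r. r powr (1 - p)) has_integral (1 powr (1 - p + 1) / (1 - p + 1))) {0..1}"
    using p by (intro has_integral_powr_from_0) auto
  then have "(\<integral>\<^sup>+r. ennreal (r powr (1 - p)) * indicator {0..1} r \<partial>lborel) = ennreal (1 / (2 - p))"
    by (subst nn_integral_has_integral_lebesgue') auto
  moreover have "(\<integral>\<^sup>+r. ennreal (r powr (1 - p)) * indicator {0..1} r \<partial>lborel)
      = (\<integral>\<^sup>+r\<in>{0<..<1}. ennreal (r powr (-p)) * ennreal r \<partial>lborel)"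
    using AE_lborel_singleton[of 0] AE_lborel_singleton[of 1]
    by (intro nn_integral_cong_AE, eventually_elim)
      (auto simp: powr_diff powr_minus field_simps simp flip: ennreal_mult split: split_indicator)
  ultimately show ?thesis by simp
qed

section \<open>The Herglotz kernel\<close>

text \<open>The factor 1/(2 pi) is chosen to match \<open>poisson_kernel\<close>, so that the total
  mass with respect to dt is 1.\<close>

definition herglotz :: "complex \<Rightarrow> complex \<Rightarrow> complex" where
  "herglotz z \<zeta> = (\<zeta> + z) / (\<zeta> - z) / of_real (2 * pi)"

lemma herglotz_rotate: "c \<noteq> 0 \<Longrightarrow> herglotz (c * z) (c * \<zeta>) = herglotz z \<zeta>"
  unfolding herglotz_def by (simp flip: distrib_left right_diff_distrib)

lemma cis_minus_nonzero: "cmod z < 1 \<Longrightarrow> cis t - z \<noteq> 0"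
  using norm_cis[of t] by auto

lemma poisson_denominator_pos:
  fixes r s :: real
  assumes "0 \<le> r" "r < 1"
  shows "1 - 2 * r * cos s + r\<^sup>2 > 0"
proof -
  have "0 < (1 - r)\<^sup>2" using assms by simp
  also have "(1 - r)\<^sup>2 \<le> 1 - 2 * r * cos s + r\<^sup>2"
    using assms mult_left_mono[OF cos_le_one[of s], of "2 * r"] by (simp add: power2_eq_square algebra_simps)
  finally show ?thesis .
qed

text \<open>The fraction is expanded by the conjugate of its denominator: |\<zeta> - z|^2 = 1 - 2 r
  cos(t - \<theta>) + r^2, and (\<zeta> + z) times the conjugate of \<zeta> - z is 1 - r^2 - 2 i r
  sin(t - \<theta>).\<close>

lemma herglotz_rcis_cis:
  assumes "0 \<le> r" "r < 1"
  shows "herglotz (rcis r \<theta>) (cis t) = Complex (poisson_kernel r (t - \<theta>))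
    (- r * sin (t - \<theta>) / (pi * (1 - 2 * r * cos (t - \<theta>) + r\<^sup>2)))"
proof -
  define D where "D = 1 - 2 * r * cos (t - \<theta>) + r\<^sup>2"
  have sc: "(sin t)\<^sup>2 + (cos t)\<^sup>2 = 1" "(sin \<theta>)\<^sup>2 + (cos \<theta>)\<^sup>2 = 1" by simp_all
  have "(cmod (cis t - rcis r \<theta>))\<^sup>2 = (cos t - r * cos \<theta>)\<^sup>2 + (sin t - r * sin \<theta>)\<^sup>2"
    by (simp add: cmod_power2)
  also have "\<dots> = ((sin t)\<^sup>2 + (cos t)\<^sup>2) + r\<^sup>2 * ((sin \<theta>)\<^sup>2 + (cos \<theta>)\<^sup>2)
      - 2 * r * (cos t * cos \<theta> + sin t * sin \<theta>)"
    by algebra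
  also have "\<dots> = D" by (simp only: sc cos_diff D_def mult_1_right)
  finally have norm_D: "(cmod (cis t - rcis r \<theta>))\<^sup>2 = D" .
  have "Re ((cis t + rcis r \<theta>) * cnj (cis t - rcis r \<theta>))
      = (cos t + r * cos \<theta>) * (cos t - r * cos \<theta>) + (sin t + r * sin \<theta>) * (sin t - r * sin \<theta>)"
    by (simp add: algebra_simps)
  also have "\<dots> = ((sin t)\<^sup>2 + (cos t)\<^sup>2) - r\<^sup>2 * ((sin \<theta>)\<^sup>2 + (cos \<theta>)\<^sup>2)"
    by algebra
  finally have re: "Re ((cis t + rcis r \<theta>) * cnj (cis t - rcis r \<theta>)) = 1 - r\<^sup>2"
    by (simp only: sc mult_1_right)
  have im: "Im ((cis t + rcis r \<theta>) * cnj (cis t - rcis r \<theta>)) = - 2 * r * sin (t - \<theta>)"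
    by (simp add: sin_diff algebra_simps)
  have "herglotz (rcis r \<theta>) (cis t) = (cis t + rcis r \<theta>) * cnj (cis t - rcis r \<theta>)
      / of_real ((cmod (cis t - rcis r \<theta>))\<^sup>2) / of_real (2 * pi)"
    unfolding herglotz_def by (subst complex_div_cnj) (simp only: of_real_power)
  then have "herglotz (rcis r \<theta>) (cis t)
      = (cis t + rcis r \<theta>) * cnj (cis t - rcis r \<theta>) / of_real (2 * pi * D)"
    by (simp only: norm_D of_real_mult divide_divide_eq_left mult.commute)
  then have "Re (herglotz (rcis r \<theta>) (cis t)) = (1 - r\<^sup>2) / (2 * pi * D)"
    and "Im (herglotz (rcis r \<theta>) (cis t)) = - 2 * r * sin (t - \<theta>) / (2 * pi * D)"
    by (simp_all only: Re_divide_of_real Im_divide_of_real re im)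
  then show ?thesis
    unfolding poisson_kernel_def D_def[symmetric] by (simp add: complex_eq_iff)
qed

lemma Re_herglotz_cis:
  "cmod z < 1 \<Longrightarrow> Re (herglotz z (cis t)) = poisson_kernel (cmod z) (t - Arg z)"
  using herglotz_rcis_cis[of "cmod z" "Arg z" t] by (simp add: rcis_cmod_Arg)

lemma Re_herglotz_cis_nonneg:
  assumes "cmod z < 1"
  shows "Re (herglotz z (cis t)) \<ge> 0"
proof -
  have "(cmod z)\<^sup>2 \<le> 1" using assms by (simp add: power_le_one)
  then show ?thesis
    using assms poisson_denominator_pos[of "cmod z" "t - Arg z"]
    by (simp add: Re_herglotz_cis poisson_kernel_def)
qed

text \<open>The derivative of (\<zeta> + z) / (\<zeta> - z) in \<zeta> is -2 z / (\<zeta> - z)^2,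
  multiplied along the circle by i \<zeta>. The factor z is the reason why integration by parts
  reaches z w_z and not w_z itself.\<close>

lemma herglotz_cis_has_vector_derivative:
  assumes "cmod z < 1"
  shows "((\<lambda>t. herglotz z (cis t)) has_vector_derivative
    (- \<i> / of_real pi * z) * (cis t / (cis t - z)\<^sup>2)) (at t within S)"
proof -
  have nz: "cis t - z \<noteq> 0" using assms by (rule cis_minus_nonzero)
  have c: "(cis has_vector_derivative \<i> * cis t) (at t within S)"
    using has_derivative_cis[OF has_derivative_ident, of t S]
    by (simp add: has_vector_derivative_def scaleR_conv_of_real mult_ac)
  have "((\<lambda>\<zeta>. (\<zeta> + z) / (\<zeta> - z)) has_field_derivative (- 2 * z / (cis t - z)\<^sup>2)) (at (cis t))"
    using nz by (auto intro!: derivative_eq_intros simp: power2_eq_square)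
  from DERIV_cdivide[OF this, of "of_real (2 * pi)"]
  have f: "((\<lambda>\<zeta>. herglotz z \<zeta>) has_field_derivative
      (- z / (of_real pi * (cis t - z)\<^sup>2))) (at (cis t))"
    by (simp add: herglotz_def[abs_def] mult_ac)
  have "((herglotz z \<circ> cis) has_vector_derivative (\<i> * cis t) * (- z / (of_real pi * (cis t - z)\<^sup>2)))
      (at t within S)"
    by (rule field_vector_diff_chain_within[OF c DERIV_subset[OF f]]) simp
  then show ?thesis by (simp add: o_def field_simps)
qed

lemma continuous_on_herglotz_cis: "cmod z < 1 \<Longrightarrow> continuous_on S (\<lambda>t. herglotz z (cis t))"
  unfolding herglotz_def using cis_minus_nonzero[of z]
  by (auto intro!: continuous_intros)

text \<open>An antiderivative of \<open>t \<mapsto> (e\<^sup>i\<^sup>t + z) / (e\<^sup>i\<^sup>t - z)\<close> is \<open>t - 2i Log (1 - z e\<^sup>-\<^sup>i\<^sup>t)\<close>,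
  whose logarithmic part is periodic because \<open>1 - z e\<^sup>-\<^sup>i\<^sup>t\<close> stays in the right half-plane.\<close>
lemma herglotz_cis_has_integral:
  assumes z: "cmod z < 1"
  shows "((\<lambda>t. herglotz z (cis t)) has_integral 1) {0..2*pi}"
proof -
  define A where "A t = (of_real t - 2 * \<i> * Ln (1 - z * cis (- t))) / of_real (2 * pi)" for t
  have "((\<lambda>t. herglotz z (cis t)) has_integral A (2 * pi) - A 0) {0..2*pi}"
  proof (rule fundamental_theorem_of_calculus)
    fix t
    have nz: "cis t - z \<noteq> 0" using z by (rule cis_minus_nonzero)
    have "cmod (z * cis (- t)) < 1" using z by (simp add: norm_mult)
    then have "Re (z * cis (- t)) < 1"
      using complex_Re_le_cmod le_less_trans by blast
    then have nonpos: "1 - z * cis (- t) \<notin> \<real>\<^sub>\<le>\<^sub>0"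
      by (auto simp: complex_nonpos_Reals_iff)
    have c: "((\<lambda>t. cis (- t)) has_vector_derivative - (\<i> * cis (- t))) (at t within {0..2*pi})"
      using has_derivative_cis[OF has_derivative_minus[OF has_derivative_ident], of t "{0..2*pi}"]
      by (simp add: has_vector_derivative_def scaleR_conv_of_real mult_ac)
    have L: "((\<lambda>w. Ln (1 - z * w)) has_field_derivative (- z / (1 - z * cis (- t)))) (at (cis (- t)))"
      using nonpos by (auto intro!: derivative_eq_intros simp: divide_inverse mult.commute)
    have "((\<lambda>t. Ln (1 - z * cis (- t))) has_vector_derivative
        - (\<i> * cis (- t)) * (- z / (1 - z * cis (- t)))) (at t within {0..2*pi})"
      using field_vector_diff_chain_within[OF c DERIV_subset[OF L]] by (simp add: o_def)
    moreover have "- (\<i> * cis (- t)) * (- z / (1 - z * cis (- t))) = \<i> * z / (cis t - z)"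
    proof -
      have "cis t * cis (- t) = 1" by (simp add: cis_mult)
      then have "1 - z * cis (- t) = cis (- t) * (cis t - z)"
        by (simp add: algebra_simps)
      moreover have "- (\<i> * c) * (- z / (c * w)) = \<i> * z / w" if "c \<noteq> 0" "w \<noteq> 0" for c w
        using that by (simp add: field_simps)
      ultimately show ?thesis using nz by simp
    qed
    ultimately have L': "((\<lambda>t. Ln (1 - z * cis (- t))) has_vector_derivative \<i> * z / (cis t - z)) (at t within {0..2*pi})"
      by simp
    have "(A has_vector_derivative (1 - 2 * \<i> * (\<i> * z / (cis t - z))) / of_real (2 * pi)) (at t within {0..2*pi})"
      unfolding A_def
      by (intro has_vector_derivative_divide has_vector_derivative_diff has_vector_derivative_mult_right L'
           has_vector_derivative_of_real[OF DERIV_ident, unfolded of_real_1])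
    moreover have "(1 - 2 * \<i> * (\<i> * z / (cis t - z))) = (cis t + z) / (cis t - z)"
    proof -
      have "(1 - 2 * \<i> * (\<i> * z / (cis t - z))) = 1 + 2 * z / (cis t - z)"
        by (simp add: mult.assoc)
      also have "\<dots> = (cis t + z) / (cis t - z)"
        using nz by (simp add: field_simps)
      finally show ?thesis .
    qed
    ultimately show "(A has_vector_derivative herglotz z (cis t)) (at t within {0..2*pi})"
      by (simp add: herglotz_def)
  qed simp
  moreover have "A (2 * pi) - A 0 = 1"
  proof -
    have "cis (- (2 * pi)) = 1" by (simp add: complex_eq_iff)
    then show ?thesis by (simp add: A_def diff_divide_distrib)
  qed
  ultimately show ?thesis by simp
qed

text \<open>Up to sign the imaginary part is \<open>q (t - \<theta>)\<close>, which has the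
  antiderivative \<open>L (t - \<theta>)\<close>, a logarithm of |\<zeta> - z|^2. On arcs where the
  sine keeps its sign the absolute value integrates to a difference of values of \<open>L\<close>;
  over a period this adds up to 2 (L pi - L 0), the contrast between the farthest and the nearest
  point of the circle.\<close>

lemma Im_herglotz_cis_abs_has_integral:
  assumes z: "cmod z < 1"
  shows "((\<lambda>t. \<bar>Im (herglotz z (cis t))\<bar>) has_integral (4 * artanh (cmod z) / pi)) {0..2*pi}"
proof -
  define r \<theta> where "r = cmod z" and "\<theta> = Arg z"
  have r: "0 \<le> r" "r < 1" using z by (auto simp: r_def)
  have \<theta>: "- pi < \<theta>" "\<theta> \<le> pi" using Arg_bounded[of z] by (auto simp: \<theta>_def)
  define D where "D s = 1 - 2 * r * cos s + r\<^sup>2" for s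
  define q where "q s = r * sin s / (pi * D s)" for s
  define L where "L s = ln (D s) / (2 * pi)" for s
  have Im: "\<bar>Im (herglotz z (cis t))\<bar> = \<bar>q (t - \<theta>)\<bar>" for t
    using herglotz_rcis_cis[OF r, of \<theta> t] by (simp add: r_def \<theta>_def q_def D_def rcis_cmod_Arg)
  have D: "D s > 0" for s unfolding D_def using r by (rule poisson_denominator_pos)
  have q_abs: "\<bar>q s\<bar> = \<epsilon> * q s" if "\<epsilon> * sin s \<ge> 0" "\<bar>\<epsilon>\<bar> = 1" for \<epsilon> s
  proof -
    have "\<epsilon> * q s = (r / (pi * D s)) * (\<epsilon> * sin s)" by (simp add: q_def)
    moreover have "r / (pi * D s) \<ge> 0" using D[of s] r by simp
    ultimately have "\<epsilon> * q s \<ge> 0" using that(1) by (simp only: mult_nonneg_nonneg)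
    then have "\<epsilon> * q s = \<bar>\<epsilon> * q s\<bar>" by simp
    then show ?thesis using that(2) by (simp add: abs_mult)
  qed
  \<comment> \<open>\<epsilon> is the constant sign of the sine on the arc.\<close>
  have piece: "((\<lambda>t. \<bar>q (t - \<theta>)\<bar>) has_integral \<epsilon> * (L (v - \<theta>) - L (u - \<theta>))) {u..v}"
    if "u \<le> v" "\<bar>\<epsilon>\<bar> = 1" "\<And>t. t \<in> {u..v} \<Longrightarrow> \<epsilon> * sin (t - \<theta>) \<ge> 0" for u v \<epsilon>
  proof (rule has_integral_eq)
    show "\<epsilon> * q (t - \<theta>) = \<bar>q (t - \<theta>)\<bar>" if "t \<in> {u..v}" for t
      using q_abs \<open>\<bar>\<epsilon>\<bar> = 1\<close> \<open>\<And>t. t \<in> {u..v} \<Longrightarrow> \<epsilon> * sin (t - \<theta>) \<ge> 0\<close> that by metis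
    have "((\<lambda>t. ln (D (t - \<theta>))) has_real_derivative 2 * (r * sin (t - \<theta>)) / D (t - \<theta>)) (at t within {u..v})" for t
      using D[of "t - \<theta>"] unfolding D_def by (auto intro!: derivative_eq_intros)
    from DERIV_cdivide[OF this, of "2 * pi"]
    have "((\<lambda>t. L (t - \<theta>)) has_real_derivative q (t - \<theta>)) (at t within {u..v})" for t
      by (simp add: L_def q_def mult_ac)
    then have "((\<lambda>t. q (t - \<theta>)) has_integral (L (v - \<theta>) - L (u - \<theta>))) {u..v}"
      using \<open>u \<le> v\<close> by (intro fundamental_theorem_of_calculus)
        (auto simp flip: has_real_derivative_iff_has_vector_derivative)
    then show "((\<lambda>t. \<epsilon> * q (t - \<theta>)) has_integral \<epsilon> * (L (v - \<theta>) - L (u - \<theta>))) {u..v}"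
      by (rule has_integral_mult_right)
  qed
  have sin_le: "sin s \<le> 0" if "pi \<le> s" "s \<le> 2 * pi" for s
    using sin_ge_zero[of "s - pi"] that by (simp add: sin_diff)
  have L_per: "L (s + 2 * pi) = L s" "L (2 * pi - s) = L s" "L (- s) = L s" for s
    by (simp_all add: L_def D_def cos_diff)
  have "2 * (L pi - L 0) = (ln ((1 + r)\<^sup>2) - ln ((1 - r)\<^sup>2)) / pi"
  proof -
    have "D pi = (1 + r)\<^sup>2" "D 0 = (1 - r)\<^sup>2"
      by (simp_all add: D_def power2_eq_square algebra_simps)
    then show ?thesis by (simp add: L_def field_simps del: power2_sum power2_diff)
  qed
  also have "\<dots> = 4 * artanh r / pi"
    using r by (simp add: ln_realpow artanh_def ln_div field_simps)
  finally have L_val: "2 * (L pi - L 0) = 4 * artanh r / pi" .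
  have "((\<lambda>t. \<bar>q (t - \<theta>)\<bar>) has_integral 2 * (L pi - L 0)) {0..2*pi}"
  \<comment> \<open>The window [0, 2 pi] is not centred at \<theta>: it is cut at \<theta> and
    \<theta> + pi if \<theta> >= 0, and at \<theta> + pi and \<theta> + 2 pi otherwise.\<close>
  proof (cases "\<theta> \<ge> 0")
    case True
    have "((\<lambda>t. \<bar>q (t - \<theta>)\<bar>) has_integral (- 1) * (L (\<theta> - \<theta>) - L (0 - \<theta>))) {0..\<theta>}"
      using True \<theta> by (intro piece) (auto intro: sin_ge_zero simp flip: sin_minus)
    moreover have "((\<lambda>t. \<bar>q (t - \<theta>)\<bar>) has_integral 1 * (L ((\<theta> + pi) - \<theta>) - L (\<theta> - \<theta>))) {\<theta>..\<theta>+pi}"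
      using True \<theta> by (intro piece) (auto intro!: sin_ge_zero)
    moreover have "((\<lambda>t. \<bar>q (t - \<theta>)\<bar>) has_integral (- 1) * (L (2 * pi - \<theta>) - L ((\<theta> + pi) - \<theta>))) {\<theta>+pi..2*pi}"
      using True \<theta> by (intro piece) (auto intro!: sin_le)
    ultimately have "((\<lambda>t. \<bar>q (t - \<theta>)\<bar>) has_integral ((- 1) * (L (\<theta> - \<theta>) - L (0 - \<theta>))
        + 1 * (L ((\<theta> + pi) - \<theta>) - L (\<theta> - \<theta>))) + (- 1) * (L (2 * pi - \<theta>) - L ((\<theta> + pi) - \<theta>))) {0..2*pi}"
      using True \<theta> by (intro has_integral_combine[of 0 "\<theta> + pi" "2 * pi"] has_integral_combine[of 0 \<theta> "\<theta> + pi"]) auto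
    then show ?thesis using L_per(2)[of \<theta>] by (simp add: L_per(3) algebra_simps)
  next
    case False
    have "((\<lambda>t. \<bar>q (t - \<theta>)\<bar>) has_integral 1 * (L ((\<theta> + pi) - \<theta>) - L (0 - \<theta>))) {0..\<theta>+pi}"
      using False \<theta> by (intro piece) (auto intro!: sin_ge_zero)
    moreover have "((\<lambda>t. \<bar>q (t - \<theta>)\<bar>) has_integral (- 1) * (L ((\<theta> + 2 * pi) - \<theta>) - L ((\<theta> + pi) - \<theta>))) {\<theta>+pi..\<theta>+2*pi}"
      using False \<theta> by (intro piece) (auto intro!: sin_le)
    moreover have "((\<lambda>t. \<bar>q (t - \<theta>)\<bar>) has_integral 1 * (L (2 * pi - \<theta>) - L ((\<theta> + 2 * pi) - \<theta>))) {\<theta>+2*pi..2*pi}"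
    proof (intro piece)
      fix t assume t: "t \<in> {\<theta>+2*pi..2*pi}"
      have "sin (t - \<theta> - 2 * pi) \<ge> 0" using t False \<theta> by (intro sin_ge_zero) auto
      then show "0 \<le> 1 * sin (t - \<theta>)" by (simp add: sin_diff[of "t - \<theta>"])
    qed (use False in auto)
    ultimately have "((\<lambda>t. \<bar>q (t - \<theta>)\<bar>) has_integral (1 * (L ((\<theta> + pi) - \<theta>) - L (0 - \<theta>))
        + (- 1) * (L ((\<theta> + 2 * pi) - \<theta>) - L ((\<theta> + pi) - \<theta>))) + 1 * (L (2 * pi - \<theta>) - L ((\<theta> + 2 * pi) - \<theta>))) {0..2*pi}"
      using False \<theta> by (intro has_integral_combine[of 0 "\<theta> + 2 * pi" "2 * pi"] has_integral_combine[of 0 "\<theta> + pi" "\<theta> + 2 * pi"]) auto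
    then show ?thesis using L_per(1)[of 0] L_per(2)[of \<theta>] by (simp add: L_per(3) algebra_simps)
  qed
  then show ?thesis unfolding Im L_val r_def .
qed

section \<open>Cauchy transforms\<close>

text \<open>This is the contour integral of f d\<zeta> / (\<zeta> - z) divided by 2 pi i; the factor
  \<open>cis t\<close> comes from d\<zeta> = i \<zeta> dt.\<close>

definition cauchy_transform :: "(real \<Rightarrow> complex) \<Rightarrow> complex \<Rightarrow> complex" where
  "cauchy_transform f z = integral {0..2*pi} (\<lambda>t. f t * (cis t / (cis t - z))) / of_real (2 * pi)"

definition cauchy_transform_deriv :: "(real \<Rightarrow> complex) \<Rightarrow> complex \<Rightarrow> complex" where
  "cauchy_transform_deriv f z = integral {0..2*pi} (\<lambda>t. f t * (cis t / (cis t - z)\<^sup>2)) / of_real (2 * pi)"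

lemma continuous_on_cauchy_kernel_deriv:
  assumes f: "continuous_on {0..2*pi} f"
  shows "continuous_on (ball 0 1 \<times> cbox 0 (2*pi)) (\<lambda>(z, t). f t * (cis t / (cis t - z)\<^sup>2))"
proof -
  have "continuous_on (ball (0::complex) 1 \<times> cbox 0 (2*pi)) (\<lambda>x. f (snd x))"
    by (rule continuous_on_compose2[OF f]) (auto intro: continuous_intros)
  then show ?thesis
    using cis_minus_nonzero by (auto simp: case_prod_unfold intro!: continuous_intros)
qed

text \<open>Differentiation under the integral sign is justified by joint continuity of the
  differentiated kernel on the open disc times the compact interval.\<close>

lemma cauchy_transform_has_field_derivative:
  assumes f: "continuous_on {0..2*pi} f" and z: "z \<in> ball 0 1"
  shows "(cauchy_transform f has_field_derivative cauchy_transform_deriv f z) (at z)"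
proof -
  have "((\<lambda>z. integral (cbox 0 (2*pi)) (\<lambda>t. f t * (cis t / (cis t - z)))) has_field_derivative
      integral (cbox 0 (2*pi)) (\<lambda>t. f t * (cis t / (cis t - z)\<^sup>2))) (at z within ball 0 1)"
  proof (rule leibniz_rule_field_derivative)
    fix w :: complex and t :: real
    assume w: "w \<in> ball 0 1"
    then have "cis t - w \<noteq> 0" by (intro cis_minus_nonzero) simp
    then show "((\<lambda>w. f t * (cis t / (cis t - w))) has_field_derivative f t * (cis t / (cis t - w)\<^sup>2)) (at w within ball 0 1)"
      by (auto intro!: derivative_eq_intros simp: power2_eq_square)
  next
    fix w :: complex
    assume "w \<in> ball 0 1"
    then have "continuous_on {0..2*pi} (\<lambda>t. f t * (cis t / (cis t - w)))"
      using cis_minus_nonzero[of w] by (auto intro!: continuous_intros f)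
    then show "(\<lambda>t. f t * (cis t / (cis t - w))) integrable_on cbox 0 (2*pi)"
      by (simp add: integrable_continuous_interval)
  qed (use z continuous_on_cauchy_kernel_deriv[OF f] in auto)
  then have "((\<lambda>z. integral {0..2*pi} (\<lambda>t. f t * (cis t / (cis t - z)))) has_field_derivative
      integral {0..2*pi} (\<lambda>t. f t * (cis t / (cis t - z)\<^sup>2))) (at z)"
    using z at_within_open[of z "ball 0 1"] by simp
  from DERIV_cdivide[OF this] show ?thesis
    by (simp add: cauchy_transform_def[abs_def] cauchy_transform_deriv_def)
qed

lemma continuous_on_cauchy_transform_deriv:
  assumes f: "continuous_on {0..2*pi} f"
  shows "continuous_on (ball 0 1) (cauchy_transform_deriv f)"
proof -
  have "continuous_on (ball 0 1) (\<lambda>z. integral (cbox 0 (2*pi)) (\<lambda>t. f t * (cis t / (cis t - z)\<^sup>2)))"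
    by (rule integral_continuous_on_param[OF continuous_on_cauchy_kernel_deriv[OF f]])
  then show ?thesis
    unfolding cauchy_transform_deriv_def by (auto intro!: continuous_intros)
qed

lemma set_integrable_mult_continuous:
  fixes f g :: "real \<Rightarrow> 'a :: {euclidean_space, real_normed_algebra}"
  assumes f: "set_integrable lborel {a..b} f" and g: "continuous_on {a..b} g"
  shows "set_integrable lborel {a..b} (\<lambda>t. f t * g t)"
proof -
  have "bounded (g ` {a..b})"
    using g by (intro compact_imp_bounded compact_continuous_image) auto
  then obtain B where B: "B > 0" "\<And>t. t \<in> {a..b} \<Longrightarrow> norm (g t) \<le> B"
    unfolding bounded_pos by blast
  have [measurable]: "(\<lambda>t. indicator {a..b} t *\<^sub>R f t) \<in> borel_measurable lborel"
    using f unfolding set_integrable_def by (rule borel_measurable_integrable)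
  have [measurable]: "(\<lambda>t. indicator {a..b} t *\<^sub>R g t) \<in> borel_measurable lborel"
    using borel_measurable_continuous_on_indicator[OF _ g] by simp
  have "integrable lborel (\<lambda>t. (indicator {a..b} t *\<^sub>R f t) * (indicator {a..b} t *\<^sub>R g t))"
  proof (rule Bochner_Integration.integrable_bound)
    show "integrable lborel (\<lambda>t. B * norm (indicator {a..b} t *\<^sub>R f t))"
      using f unfolding set_integrable_def by (intro integrable_mult_right integrable_norm)
    show "AE t in lborel. norm ((indicator {a..b} t *\<^sub>R f t) * (indicator {a..b} t *\<^sub>R g t))
        \<le> norm (B * norm (indicator {a..b} t *\<^sub>R f t))"
    proof (rule AE_I2)
      fix t
      have "norm (indicator {a..b} t *\<^sub>R g t) \<le> B"
        using B by (auto split: split_indicator)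
      then have "norm (indicator {a..b} t *\<^sub>R f t) * norm (indicator {a..b} t *\<^sub>R g t)
          \<le> norm (indicator {a..b} t *\<^sub>R f t) * B"
        by (intro mult_left_mono) auto
      then show "norm ((indicator {a..b} t *\<^sub>R f t) * (indicator {a..b} t *\<^sub>R g t))
        \<le> norm (B * norm (indicator {a..b} t *\<^sub>R f t))"
        using B(1) order_trans[OF norm_mult_ineq]
        by (simp only: real_norm_def abs_mult abs_norm_cancel abs_of_pos mult.commute[of B])
    qed
  qed measurable
  also have "(\<lambda>t. (indicator {a..b} t *\<^sub>R f t) * (indicator {a..b} t *\<^sub>R g t))
      = (\<lambda>t. indicator {a..b} t *\<^sub>R (f t * g t))"
    by (auto simp: fun_eq_iff split: split_indicator)
  finally show ?thesis unfolding set_integrable_def .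
qed

lemma lipschitz_on_herglotz_cis:
  assumes z: "cmod z < 1"
  obtains L where "L-lipschitz_on {0..2*pi} (\<lambda>t. herglotz z (cis t))"
proof -
  let ?d = "\<lambda>t. (- \<i> / of_real pi * z) * (cis t / (cis t - z)\<^sup>2)"
  have "continuous_on {0..2*pi} ?d"
    using cis_minus_nonzero[OF z] by (auto intro!: continuous_intros)
  then have "bounded (?d ` {0..2*pi})"
    by (intro compact_imp_bounded compact_continuous_image) auto
  then obtain L where L: "L > 0" "\<And>t. t \<in> {0..2*pi} \<Longrightarrow> norm (?d t) \<le> L"
    unfolding bounded_pos by blast
  have "L-lipschitz_on {0..2*pi} (\<lambda>t. herglotz z (cis t))"
  proof (rule bounded_derivative_imp_lipschitz)
    fix t assume t: "t \<in> {0..2*pi}"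
    show "((\<lambda>t. herglotz z (cis t)) has_derivative (\<lambda>h. h *\<^sub>R ?d t)) (at t within {0..2*pi})"
      using herglotz_cis_has_vector_derivative[OF z] by (simp add: has_vector_derivative_def)
    have "norm (h *\<^sub>R ?d t) \<le> L * norm h" for h :: real
      unfolding norm_scaleR using mult_left_mono[OF L(2)[OF t], of "norm h"] by (simp add: mult.commute)
    then show "onorm (\<lambda>h. h *\<^sub>R ?d t) \<le> L"
      using L(1) by (intro onorm_bound) auto
  qed (use L(1) in auto)
  then show thesis by (rule that)
qed

text \<open>Integration by parts, with the Herglotz kernel as the antiderivative of the Cauchy kernel.\<close>
lemma cauchy_transform_deriv_eq:
  assumes z: "cmod z < 1"
    and ac: "abs_continuous_on 0 (2*pi) f" and per: "f (2*pi) = f 0"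
    and deriv: "AE t in lborel. t \<in> {0..2*pi} \<longrightarrow> (f has_vector_derivative d t) (at t)"
    and d: "set_integrable lborel {0..2*pi} d"
  shows "z * cauchy_transform_deriv f z
    = - \<i> / 2 * (LINT t:{0..2*pi}|lborel. d t * herglotz z (cis t))"
proof -
  let ?\<phi> = "\<lambda>t. herglotz z (cis t)"
  let ?\<phi>' = "\<lambda>t. (- \<i> / of_real pi * z) * (cis t / (cis t - z)\<^sup>2)"
  have f: "continuous_on {0..2*pi} f" using ac by (rule abs_continuous_on_imp_continuous_on)
  obtain L where "L-lipschitz_on {0..2*pi} ?\<phi>" using lipschitz_on_herglotz_cis[OF z] .
  with ac have ac': "abs_continuous_on 0 (2*pi) (\<lambda>t. f t * ?\<phi> t)"
    by (rule abs_continuous_on_mult_lipschitz)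
  obtain N where N: "N \<in> null_sets lborel" "{t. \<not> (t \<in> {0..2*pi} \<longrightarrow> (f has_vector_derivative d t) (at t))} \<subseteq> N"
    using deriv by (auto elim!: AE_E simp: null_sets_def)
  have negl: "negligible N"
    using N(1) by (simp add: negligible_iff_null_sets null_sets_completionI)
  have "((\<lambda>t. f t * ?\<phi>' t + d t * ?\<phi> t) has_integral f (2*pi) * ?\<phi> (2*pi) - f 0 * ?\<phi> 0) {0..2*pi}"
  proof (rule fundamental_theorem_of_calculus_abs_continuous[OF _ ac' negl])
    fix t assume "t \<in> {0..2*pi} - N"
    then have "(f has_vector_derivative d t) (at t within {0..2*pi})"
      using N(2) has_vector_derivative_at_within by blast
    then show "((\<lambda>t. f t * ?\<phi> t) has_vector_derivative f t * ?\<phi>' t + d t * ?\<phi> t) (at t within {0..2*pi})"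
      using herglotz_cis_has_vector_derivative[OF z] by (rule has_vector_derivative_mult)
  qed simp
  \<comment> \<open>Both factors are periodic, so the boundary terms cancel.\<close>
  moreover have "?\<phi> (2*pi) = ?\<phi> 0" by simp
  ultimately have total: "((\<lambda>t. f t * ?\<phi>' t + d t * ?\<phi> t) has_integral 0) {0..2*pi}"
    by (simp add: per)
  have "continuous_on {0..2*pi} (\<lambda>t. f t * (cis t / (cis t - z)\<^sup>2))"
    using f cis_minus_nonzero[OF z] by (auto intro!: continuous_intros)
  then have "((\<lambda>t. f t * (cis t / (cis t - z)\<^sup>2)) has_integral of_real (2 * pi) * cauchy_transform_deriv f z) {0..2*pi}"
    by (simp add: cauchy_transform_deriv_def integrable_integral integrable_continuous_interval)
  then have "((\<lambda>t. (- \<i> / of_real pi * z) * (f t * (cis t / (cis t - z)\<^sup>2))) has_integral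
      (- \<i> / of_real pi * z) * (of_real (2 * pi) * cauchy_transform_deriv f z)) {0..2*pi}"
    by (rule has_integral_mult_right)
  then have "((\<lambda>t. f t * ?\<phi>' t) has_integral - 2 * \<i> * (z * cauchy_transform_deriv f z)) {0..2*pi}"
    by (simp add: mult_ac)
  from has_integral_diff[OF total this]
  have "((\<lambda>t. d t * ?\<phi> t) has_integral 2 * \<i> * (z * cauchy_transform_deriv f z)) {0..2*pi}"
    by simp
  \<comment> \<open>So far the identity concerns the gauge integral; absolute integrability
    identifies it with the Lebesgue integral.\<close>
  moreover have "set_integrable lborel {0..2*pi} (\<lambda>t. d t * ?\<phi> t)"
    using d continuous_on_herglotz_cis[OF z] by (rule set_integrable_mult_continuous)
  ultimately have "(LINT t:{0..2*pi}|lborel. d t * ?\<phi> t) = 2 * \<i> * (z * cauchy_transform_deriv f z)"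
    using set_borel_integral_eq_integral[of "{0..2*pi}" "\<lambda>t. d t * ?\<phi> t"]
    by (simp add: has_integral_iff)
  then show ?thesis by (simp add: mult.assoc[symmetric])
qed

section \<open>The norm estimates\<close>

lemma powr_set_integral_weighted_le:
  fixes K g :: "'a \<Rightarrow> real"
  assumes "p \<ge> 1" "\<And>x. x \<in> A \<Longrightarrow> K x \<ge> 0" "\<And>x. g x \<ge> 0"
    and "set_integrable M A K" "set_integrable M A (\<lambda>x. K x * g x)" "set_integrable M A (\<lambda>x. K x * g x powr p)"
    and "(LINT x:A|M. K x) > 0"
  shows "(LINT x:A|M. K x * g x) powr p
    \<le> (LINT x:A|M. K x) powr (p - 1) * (LINT x:A|M. K x * g x powr p)"
  using powr_integral_weighted_le[of p M "\<lambda>x. indicator A x * K x" g] assms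
  by (simp add: set_lebesgue_integral_def set_integrable_def mult.assoc indicator_def)

lemma ennreal_set_integral_eq:
  fixes f :: "'a \<Rightarrow> real"
  assumes "set_integrable M A f" "\<And>x. x \<in> A \<Longrightarrow> f x \<ge> 0"
  shows "ennreal (LINT x:A|M. f x) = (\<integral>\<^sup>+x\<in>A. ennreal (f x) \<partial>M)"
proof -
  have "(\<integral>\<^sup>+x. ennreal (indicator A x *\<^sub>R f x) \<partial>M) = ennreal (LINT x|M. indicator A x *\<^sub>R f x)"
    using assms unfolding set_integrable_def
    by (intro nn_integral_eq_integral) (auto split: split_indicator)
  moreover have "(\<integral>\<^sup>+x. ennreal (indicator A x *\<^sub>R f x) \<partial>M) = (\<integral>\<^sup>+x\<in>A. ennreal (f x) \<partial>M)"
    by (intro nn_integral_cong) (auto split: split_indicator)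
  ultimately show ?thesis by (simp add: set_lebesgue_integral_def)
qed

text \<open>Returns from [0, \<infinity>], where Tonelli is applied, to the real integrals of the
  norms.\<close>

lemma set_integrable_of_nn_integral_le:
  fixes f :: "'a \<Rightarrow> real"
  assumes "set_borel_measurable M A f" "\<And>x. x \<in> A \<Longrightarrow> f x \<ge> 0" "B \<ge> 0"
    and le: "(\<integral>\<^sup>+x\<in>A. ennreal (f x) \<partial>M) \<le> ennreal B"
  shows "set_integrable M A f" and "(LINT x:A|M. f x) \<le> B"
proof -
  have eq: "(\<integral>\<^sup>+x\<in>A. ennreal (f x) \<partial>M) = (\<integral>\<^sup>+x. ennreal (indicator A x *\<^sub>R f x) \<partial>M)"
    by (intro nn_integral_cong) (auto split: split_indicator)
  show int: "set_integrable M A f"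
    unfolding set_integrable_def
  proof (rule integrableI_nonneg)
    show "(\<integral>\<^sup>+x. ennreal (indicator A x *\<^sub>R f x) \<partial>M) < \<infinity>"
      using le eq le_less_trans[OF _ ennreal_less_top] by (simp add: top.not_eq_extremum)
  qed (use assms in \<open>auto simp: set_borel_measurable_def split: split_indicator\<close>)
  have "ennreal (LINT x:A|M. f x) \<le> ennreal B"
    using ennreal_set_integral_eq[OF int assms(2)] le by simp
  then show "(LINT x:A|M. f x) \<le> B"
    using assms(3) by (simp add: ennreal_le_iff)
qed

text \<open>The power of |z| comes from dividing z w_z by z. The factor before the imaginary part is
  (mass)^(p-1) from Jensen's inequality; for the real part, of mass 1, that factor is 1. The 1/2
  from midpoint convexity is kept outside.\<close>

definition disc_kernel :: "real \<Rightarrow> complex \<Rightarrow> complex \<Rightarrow> real" where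
  "disc_kernel p z \<zeta> = cmod z powr (- p) * (Re (herglotz z \<zeta>)
     + (4 * artanh (cmod z) / pi) powr (p - 1) * \<bar>Im (herglotz z \<zeta>)\<bar>)"

lemma disc_kernel_cis_nonneg: "cmod z < 1 \<Longrightarrow> disc_kernel p z (cis t) \<ge> 0"
  using Re_herglotz_cis_nonneg[of z t] by (simp add: disc_kernel_def)

text \<open>The Jensen factor \<kappa>^(p-1) meets the mass \<kappa> of the imaginary part and
  becomes \<kappa>^p.\<close>

lemma disc_kernel_cis_has_integral:
  assumes z: "cmod z < 1" "z \<noteq> 0"
  shows "((\<lambda>t. disc_kernel p z (cis t)) has_integral
    (cmod z powr (- p) * (1 + (4 * artanh (cmod z) / pi) powr p))) {0..2*pi}"
proof -
  have pos: "4 * artanh (cmod z) / pi > 0" using z artanh_pos[of "cmod z"] by simp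
  have "((\<lambda>t. Re (herglotz z (cis t))) has_integral 1) {0..2*pi}"
    using has_integral_linear[OF herglotz_cis_has_integral[OF z(1)] bounded_linear_Re]
    by (simp add: o_def)
  then have "((\<lambda>t. disc_kernel p z (cis t)) has_integral
    (cmod z powr (- p) * (1 + (4 * artanh (cmod z) / pi) powr (p - 1) * (4 * artanh (cmod z) / pi)))) {0..2*pi}"
    unfolding disc_kernel_def
    by (intro has_integral_mult_right has_integral_add Im_herglotz_cis_abs_has_integral z(1))
  moreover have "x powr (p - 1) * x = x powr p" if "x > 0" for x :: real
    using that by (simp add: powr_diff)
  ultimately show ?thesis using pos by metis
qed

lemma borel_measurable_disc_kernel [measurable]:
  "(\<lambda>(z, \<zeta>). disc_kernel p z \<zeta>) \<in> borel_measurable (borel \<Otimes>\<^sub>M borel)"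
  unfolding disc_kernel_def herglotz_def by measurable

lemma C_const_nonneg: "C_const p \<ge> 0"
  unfolding C_const_def set_lebesgue_integral_def
  by (intro Bochner_Integration.integral_nonneg) (auto split: split_indicator)

text \<open>By rotation invariance only the slice masses \<open>h r\<close> count. Against r dr, the
  summand 1 in \<open>h\<close> yields the integral of r^(1-p), and the other one yields
  \<open>C_const p\<close>.\<close>

lemma nn_integral_disc_kernel_le:
  assumes p: "1 \<le> p" "p < 2"
  shows "(\<integral>\<^sup>+z\<in>ball 0 1. ennreal (disc_kernel p z (cis s)) \<partial>lborel) \<le> ennreal (C_const p + 1 / (2 - p))"
proof -
  define h where "h r = ennreal (r powr (- p) * (1 + (4 * artanh r / pi) powr p))" for r :: real
  have [measurable]: "h \<in> borel_measurable borel" unfolding h_def by measurable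
  have "(\<integral>\<^sup>+z\<in>ball 0 1. ennreal (disc_kernel p z (cis s)) \<partial>lborel)
      \<le> (\<integral>\<^sup>+r\<in>{0<..<1}. h r * ennreal r \<partial>lborel)"
  proof (rule nn_integral_disc_rotation_invariant_le)
    show "(\<lambda>(z, \<zeta>). ennreal (disc_kernel p z \<zeta>)) \<in> borel_measurable (borel \<Otimes>\<^sub>M borel)"
      by measurable
    show "ennreal (disc_kernel p (c * z) (c * \<zeta>)) = ennreal (disc_kernel p z \<zeta>)"
      if "norm c = 1" for c z \<zeta>
    proof -
      have "c \<noteq> 0" using that by auto
      then show ?thesis using that by (simp add: disc_kernel_def herglotz_rotate norm_mult)
    qed
    show "(\<integral>\<^sup>+t\<in>{0..2*pi}. ennreal (disc_kernel p z (cis t)) \<partial>lborel) \<le> h (norm z)"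
      if "z \<in> ball 0 1" "z \<noteq> 0" for z
      using that disc_kernel_cis_nonneg disc_kernel_cis_has_integral[of z p] unfolding h_def
      by (subst nn_integral_has_integral_lebesgue') auto
  qed measurable
  also have "\<dots> = (\<integral>\<^sup>+r\<in>{0<..<1}. ennreal (r powr (- p)) * ennreal r \<partial>lborel)
      + (\<integral>\<^sup>+r\<in>{0<..<1}. ennreal (((4 * artanh r) / (pi * r)) powr p * r) \<partial>lborel)"
  proof (subst nn_integral_add[symmetric])
    have "h r * ennreal r = ennreal (r powr (- p)) * ennreal r + ennreal (((4 * artanh r) / (pi * r)) powr p * r)"
      if r: "0 < r" "r < 1" for r
    proof -
      have "r powr (- p) * (4 * artanh r / pi) powr p = ((4 * artanh r) / (pi * r)) powr p"
        using r artanh_pos[OF r] by (simp add: powr_minus powr_divide powr_mult field_simps)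
      then have "r powr (- p) * (1 + (4 * artanh r / pi) powr p) * r
          = r powr (- p) * r + ((4 * artanh r) / (pi * r)) powr p * r"
        by (simp add: distrib_left distrib_right)
      then show ?thesis
        using r by (simp add: h_def flip: ennreal_mult ennreal_plus)
    qed
    then show "(\<integral>\<^sup>+r\<in>{0<..<1}. h r * ennreal r \<partial>lborel)
      = (\<integral>\<^sup>+r. ennreal (r powr (- p)) * ennreal r * indicator {0<..<1} r
          + ennreal (((4 * artanh r) / (pi * r)) powr p * r) * indicator {0<..<1} r \<partial>lborel)"
      by (intro nn_integral_cong) (auto split: split_indicator)
  qed measurable
  also have "(\<integral>\<^sup>+r\<in>{0<..<1}. ennreal (((4 * artanh r) / (pi * r)) powr p * r) \<partial>lborel) = ennreal (C_const p)"
    unfolding C_const_def using set_integrable_C_const[OF p]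
    by (subst ennreal_set_integral_eq) auto
  also have "(\<integral>\<^sup>+r\<in>{0<..<1}. ennreal (r powr (- p)) * ennreal r \<partial>lborel) = ennreal (1 / (2 - p))"
    using p by (rule nn_integral_powr_unit_interval)
  also have "ennreal (1 / (2 - p)) + ennreal (C_const p) = ennreal (C_const p + 1 / (2 - p))"
    using p C_const_nonneg[of p] by (subst ennreal_plus[symmetric]) (auto simp: add.commute)
  finally show ?thesis .
qed

text \<open>The pointwise heart of the estimate: |z| |c| is at most the midpoint of \<open>a\<close>
  and \<open>b\<close>, the averages of |d| against Re and |Im| of the Herglotz kernel. Convexity
  separates them, and each is bounded by Jensen's inequality with its own mass, 1 or
  \<kappa>.\<close>

lemma cauchy_transform_deriv_powr_le:
  assumes p: "1 \<le> p" and z: "cmod z < 1" "z \<noteq> 0"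
    and eq: "z * c = - \<i> / 2 * (LINT t:{0..2*pi}|lborel. d t * herglotz z (cis t))"
    and d: "set_integrable lborel {0..2*pi} d" "set_integrable lborel {0..2*pi} (\<lambda>t. cmod (d t) powr p)"
  shows "ennreal (cmod c powr p)
    \<le> (\<integral>\<^sup>+t\<in>{0..2*pi}. ennreal (1/2 * (disc_kernel p z (cis t) * cmod (d t) powr p)) \<partial>lborel)"
proof -
  let ?A = "{0..2*pi}" and ?h = "\<lambda>t. herglotz z (cis t)"
  define \<kappa> where "\<kappa> = 4 * artanh (cmod z) / pi"
  have \<kappa>: "\<kappa> > 0" using z artanh_pos[of "cmod z"] by (simp add: \<kappa>_def)
  have h: "continuous_on ?A ?h" using z(1) by (rule continuous_on_herglotz_cis)
  have Re_h: "continuous_on ?A (\<lambda>t. Re (?h t))" and Im_h: "continuous_on ?A (\<lambda>t. \<bar>Im (?h t)\<bar>)"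
    using h by (auto intro!: continuous_intros)
  have g: "set_integrable lborel ?A (\<lambda>t. cmod (d t))"
    using d(1) by (rule set_integrable_norm)
  have int_Re: "set_integrable lborel ?A (\<lambda>t. Re (?h t))" "set_integrable lborel ?A (\<lambda>t. \<bar>Im (?h t)\<bar>)"
    using Re_h Im_h by (auto intro: borel_integrable_atLeastAtMost')
  have int_g: "set_integrable lborel ?A (\<lambda>t. Re (?h t) * cmod (d t))"
      "set_integrable lborel ?A (\<lambda>t. \<bar>Im (?h t)\<bar> * cmod (d t))"
    using set_integrable_mult_continuous[OF g Re_h] set_integrable_mult_continuous[OF g Im_h]
    by (simp_all add: mult.commute)
  have int_gp: "set_integrable lborel ?A (\<lambda>t. Re (?h t) * cmod (d t) powr p)"
      "set_integrable lborel ?A (\<lambda>t. \<bar>Im (?h t)\<bar> * cmod (d t) powr p)"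
    using set_integrable_mult_continuous[OF d(2) Re_h] set_integrable_mult_continuous[OF d(2) Im_h]
    by (simp_all add: mult.commute)
  have LINT_Re: "(LINT t:?A|lborel. Re (?h t)) = 1"
    using has_integral_linear[OF herglotz_cis_has_integral[OF z(1)] bounded_linear_Re]
    by (subst set_borel_integral_eq_integral(2)[OF int_Re(1)]) (auto simp: o_def)
  have LINT_Im: "(LINT t:?A|lborel. \<bar>Im (?h t)\<bar>) = \<kappa>"
    using Im_herglotz_cis_abs_has_integral[OF z(1)]
    by (subst set_borel_integral_eq_integral(2)[OF int_Re(2)]) (auto simp: \<kappa>_def)
  define a b where "a = (LINT t:?A|lborel. Re (?h t) * cmod (d t))"
    and "b = (LINT t:?A|lborel. \<bar>Im (?h t)\<bar> * cmod (d t))"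
  define a' b' where "a' = (LINT t:?A|lborel. Re (?h t) * cmod (d t) powr p)"
    and "b' = (LINT t:?A|lborel. \<bar>Im (?h t)\<bar> * cmod (d t) powr p)"
  have ab: "a \<ge> 0" "b \<ge> 0"
    unfolding a_def b_def set_lebesgue_integral_def using Re_herglotz_cis_nonneg[OF z(1)]
    by (auto intro!: Bochner_Integration.integral_nonneg)
  have "a powr p \<le> (LINT t:?A|lborel. Re (?h t)) powr (p - 1) * a'"
    unfolding a_def a'_def using p int_Re int_g int_gp Re_herglotz_cis_nonneg[OF z(1)]
    by (intro powr_set_integral_weighted_le) (auto simp: LINT_Re)
  then have a_le: "a powr p \<le> a'" by (simp add: LINT_Re)
  have "b powr p \<le> (LINT t:?A|lborel. \<bar>Im (?h t)\<bar>) powr (p - 1) * b'"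
    unfolding b_def b'_def using p int_Re int_g int_gp \<kappa>
    by (intro powr_set_integral_weighted_le) (auto simp: LINT_Im)
  then have b_le: "b powr p \<le> \<kappa> powr (p - 1) * b'" by (simp add: LINT_Im)
  have "cmod z * cmod c = cmod (z * c)" by (simp add: norm_mult)
  also have "\<dots> = cmod (LINT t:?A|lborel. d t * ?h t) / 2"
    unfolding eq by (simp add: norm_mult)
  also have "cmod (LINT t:?A|lborel. d t * ?h t) \<le> (LINT t:?A|lborel. cmod (d t * ?h t))"
    using set_integrable_mult_continuous[OF d(1) h] by (rule set_integral_norm_bound)
  also have "\<dots> \<le> (LINT t:?A|lborel. Re (?h t) * cmod (d t) + \<bar>Im (?h t)\<bar> * cmod (d t))"
  proof (rule set_integral_mono)
    fix t
    have "cmod (?h t) \<le> Re (?h t) + \<bar>Im (?h t)\<bar>"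
      using cmod_le[of "?h t"] Re_herglotz_cis_nonneg[OF z(1), of t] by simp
    then show "cmod (d t * ?h t) \<le> Re (?h t) * cmod (d t) + \<bar>Im (?h t)\<bar> * cmod (d t)"
      using mult_right_mono[of "cmod (?h t)" "Re (?h t) + \<bar>Im (?h t)\<bar>" "cmod (d t)"]
      by (simp only: norm_mult mult.commute[of "cmod (d t)"] distrib_right norm_ge_zero)
  qed (use int_g set_integrable_mult_continuous[OF d(1) h] in \<open>auto intro: set_integrable_norm\<close>)
  also have "\<dots> = a + b"
    using int_g by (simp add: a_def b_def set_integral_add)
  finally have "cmod z * cmod c \<le> (a + b) / 2" by simp
  \<comment> \<open>The 1/2 of the by-parts identity becomes the weight of the midpoint, so a factor
    1/2 survives, whatever p is.\<close>
  then have "(cmod z * cmod c) powr p \<le> ((a + b) / 2) powr p"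
    using p by (intro powr_mono2) auto
  also have "\<dots> \<le> (a powr p + b powr p) / 2"
    using p ab by (intro powr_half_sum_le)
  also have "\<dots> \<le> (a' + \<kappa> powr (p - 1) * b') / 2"
    using a_le b_le by simp
  finally have le: "(cmod z * cmod c) powr p \<le> (a' + \<kappa> powr (p - 1) * b') / 2" .
  have int_K: "set_integrable lborel ?A (\<lambda>t. 1/2 * (disc_kernel p z (cis t) * cmod (d t) powr p))"
    and LINT_K: "(LINT t:?A|lborel. 1/2 * (disc_kernel p z (cis t) * cmod (d t) powr p))
      = cmod z powr (- p) * ((a' + \<kappa> powr (p - 1) * b') / 2)"
  proof -
    have K: "(\<lambda>t. 1/2 * (disc_kernel p z (cis t) * cmod (d t) powr p))
      = (\<lambda>t. (cmod z powr (- p) / 2) * (Re (?h t) * cmod (d t) powr p)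
          + (cmod z powr (- p) / 2 * \<kappa> powr (p - 1)) * (\<bar>Im (?h t)\<bar> * cmod (d t) powr p))"
      by (simp add: fun_eq_iff disc_kernel_def \<kappa>_def algebra_simps)
    show "set_integrable lborel ?A (\<lambda>t. 1/2 * (disc_kernel p z (cis t) * cmod (d t) powr p))"
      unfolding K using int_gp by (intro set_integral_add set_integrable_mult_right) auto
    show "(LINT t:?A|lborel. 1/2 * (disc_kernel p z (cis t) * cmod (d t) powr p))
      = cmod z powr (- p) * ((a' + \<kappa> powr (p - 1) * b') / 2)"
    proof -
      have "(LINT t:?A|lborel. u * (Re (?h t) * cmod (d t) powr p) + v * (\<bar>Im (?h t)\<bar> * cmod (d t) powr p))
          = u * a' + v * b'" for u v
        using int_gp by (simp add: a'_def b'_def set_integral_add)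
      then show ?thesis unfolding K by (simp only:) (simp add: algebra_simps add_divide_distrib)
    qed
  qed
  have "cmod c powr p = cmod z powr (- p) * (cmod z * cmod c) powr p"
    using z by (simp add: powr_mult powr_minus field_simps)
  also have "\<dots> \<le> cmod z powr (- p) * ((a' + \<kappa> powr (p - 1) * b') / 2)"
    using le by (intro mult_left_mono) auto
  finally have "ennreal (cmod c powr p) \<le> ennreal (LINT t:?A|lborel. 1/2 * (disc_kernel p z (cis t) * cmod (d t) powr p))"
    unfolding LINT_K by (rule ennreal_leI)
  also have "\<dots> = (\<integral>\<^sup>+t\<in>?A. ennreal (1/2 * (disc_kernel p z (cis t) * cmod (d t) powr p)) \<partial>lborel)"
    using disc_kernel_cis_nonneg[OF z(1)] by (intro ennreal_set_integral_eq[OF int_K]) auto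
  finally show ?thesis .
qed

lemma nn_integral_cauchy_transform_deriv_le:
  assumes p: "1 \<le> p" "p < 2"
    and ac: "abs_continuous_on 0 (2*pi) f" and per: "f (2*pi) = f 0"
    and deriv: "AE t in lborel. t \<in> {0..2*pi} \<longrightarrow> (f has_vector_derivative d t) (at t)"
    and d: "set_integrable lborel {0..2*pi} d" "set_integrable lborel {0..2*pi} (\<lambda>t. cmod (d t) powr p)"
  shows "(\<integral>\<^sup>+z\<in>ball 0 1. ennreal (cmod (cauchy_transform_deriv f z) powr p) \<partial>lborel)
    \<le> ennreal ((C_const p + 1 / (2 - p)) / 2 * (LINT t:{0..2*pi}|lborel. cmod (d t) powr p))"
proof -
  \<comment> \<open>The values of \<open>d\<close> outside the interval are arbitrary; with the
    indicator inside, \<open>G\<close> is Borel measurable on the whole line, as Tonelli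
    requires.\<close>
  define G where "G t = ennreal (indicator {0..2*pi} t * cmod (d t) powr p)" for t
  have [measurable]: "(\<lambda>t. indicator {0..2*pi} t * cmod (d t) powr p) \<in> borel_measurable borel"
    using borel_measurable_integrable[OF d(2)[unfolded set_integrable_def]] by simp
  then have [measurable]: "G \<in> borel_measurable borel" unfolding G_def by measurable
  have [measurable]: "cis \<in> borel_measurable borel"
    by (auto intro!: borel_measurable_continuous_onI continuous_intros)
  have "(\<integral>\<^sup>+z\<in>ball 0 1. ennreal (cmod (cauchy_transform_deriv f z) powr p) \<partial>lborel)
      \<le> (\<integral>\<^sup>+z. (\<integral>\<^sup>+t. ennreal (1/2) * (ennreal (disc_kernel p z (cis t)) * G t * indicator (ball 0 1) z) \<partial>lborel) \<partial>lborel)"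
  proof (rule nn_integral_mono_AE)
    show "AE z in lborel. ennreal (cmod (cauchy_transform_deriv f z) powr p) * indicator (ball 0 1) z
        \<le> (\<integral>\<^sup>+t. ennreal (1/2) * (ennreal (disc_kernel p z (cis t)) * G t * indicator (ball 0 1) z) \<partial>lborel)"
      \<comment> \<open>The pointwise bound divides by z, so the origin is discarded as a null
        set.\<close>
      using AE_lborel_singleton[of "0::complex"]
    proof eventually_elim
      fix z :: complex assume z0: "z \<noteq> 0"
      show "ennreal (cmod (cauchy_transform_deriv f z) powr p) * indicator (ball 0 1) z
        \<le> (\<integral>\<^sup>+t. ennreal (1/2) * (ennreal (disc_kernel p z (cis t)) * G t * indicator (ball 0 1) z) \<partial>lborel)"
      proof (cases "z \<in> ball 0 1")
        case True
        then have z: "cmod z < 1" by simp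
        have "ennreal (cmod (cauchy_transform_deriv f z) powr p)
            \<le> (\<integral>\<^sup>+t\<in>{0..2*pi}. ennreal (1/2 * (disc_kernel p z (cis t) * cmod (d t) powr p)) \<partial>lborel)"
          by (rule cauchy_transform_deriv_powr_le[OF p(1) z z0 cauchy_transform_deriv_eq[OF z ac per deriv d(1)] d])
        also have "\<dots> = (\<integral>\<^sup>+t. ennreal (1/2) * (ennreal (disc_kernel p z (cis t)) * G t * indicator (ball 0 1) z) \<partial>lborel)"
        proof (rule nn_integral_cong)
          fix t
          have "ennreal (1/2 * (disc_kernel p z (cis t) * x)) = ennreal (1/2) * (ennreal (disc_kernel p z (cis t)) * ennreal x)" for x
            using disc_kernel_cis_nonneg[OF z, of p t] by (subst ennreal_mult', simp, subst ennreal_mult') simp_all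
          then show "ennreal (1/2 * (disc_kernel p z (cis t) * cmod (d t) powr p)) * indicator {0..2*pi} t
              = ennreal (1/2) * (ennreal (disc_kernel p z (cis t)) * G t * indicator (ball 0 1) z)"
            using True by (auto simp only: G_def split: split_indicator) simp_all
        qed
        finally show ?thesis using True by simp
      qed simp
    qed
  qed
  also have "\<dots> = (\<integral>\<^sup>+t. (\<integral>\<^sup>+z. ennreal (1/2) * (ennreal (disc_kernel p z (cis t)) * G t * indicator (ball 0 1) z) \<partial>lborel) \<partial>lborel)"
    by (rule lborel_pair.Fubini') measurable
  also have "\<dots> = (\<integral>\<^sup>+t. ennreal (1/2) * G t * (\<integral>\<^sup>+z\<in>ball 0 1. ennreal (disc_kernel p z (cis t)) \<partial>lborel) \<partial>lborel)"
    by (subst nn_integral_cmult[symmetric]) (auto simp: mult_ac)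
  also have "\<dots> \<le> (\<integral>\<^sup>+t. ennreal (1/2) * G t * ennreal (C_const p + 1 / (2 - p)) \<partial>lborel)"
    by (intro nn_integral_mono mult_left_mono nn_integral_disc_kernel_le p) auto
  also have "\<dots> = ennreal ((C_const p + 1 / (2 - p)) / 2) * (\<integral>\<^sup>+t. G t \<partial>lborel)"
  proof -
    have "ennreal (1/2) * G t * ennreal (C_const p + 1 / (2 - p)) = ennreal ((C_const p + 1 / (2 - p)) / 2) * G t" for t
      using ennreal_mult'[of "1/2" "C_const p + 1 / (2 - p)"] by (simp add: mult_ac)
    then show ?thesis by (simp add: nn_integral_cmult)
  qed
  also have "(\<integral>\<^sup>+t. G t \<partial>lborel) = ennreal (LINT t:{0..2*pi}|lborel. cmod (d t) powr p)"
    by (subst ennreal_set_integral_eq[OF d(2)]) (auto simp: G_def intro!: nn_integral_cong split: split_indicator)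
  also have "ennreal ((C_const p + 1 / (2 - p)) / 2) * \<dots>
      = ennreal ((C_const p + 1 / (2 - p)) / 2 * (LINT t:{0..2*pi}|lborel. cmod (d t) powr p))"
    using p C_const_nonneg[of p] by (subst ennreal_mult') auto
  finally show ?thesis .
qed

lemma cauchy_transform_deriv_Lp:
  assumes p: "1 \<le> p" "p < 2"
    and ac: "abs_continuous_on 0 (2*pi) f" and per: "f (2*pi) = f 0"
    and deriv: "AE t in lborel. t \<in> {0..2*pi} \<longrightarrow> (f has_vector_derivative d t) (at t)"
    and d_meas: "set_borel_measurable lborel {0..2*pi} d"
    and d_Lp: "set_integrable lborel {0..2*pi} (\<lambda>t. cmod (d t) powr p)"
  shows "set_borel_measurable lborel (ball 0 1) (cauchy_transform_deriv f)"
    and "set_integrable lborel (ball 0 1) (\<lambda>z. cmod (cauchy_transform_deriv f z) powr p)"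
    and "Lp_norm_disk p (cauchy_transform_deriv f)
      \<le> (C_const p + 1 / (2 - p)) powr (1/p) * Lp_norm_circle p d"
proof -
  \<comment> \<open>On a bounded interval L^p lies in L^1, by x <= 1 + x^p.\<close>
  have d: "set_integrable lborel {0..2*pi} d"
  proof (rule set_integrable_bound)
    show "set_integrable lborel {0..2*pi} (\<lambda>t. 1 + cmod (d t) powr p)"
      using d_Lp by (intro set_integral_add) (auto intro!: borel_integrable_atLeastAtMost')
    have "x \<le> 1 + x powr p" if "x \<ge> 0" for x :: real
    proof (cases "x \<le> 1")
      case False
      then show ?thesis using powr_mono[of 1 p x] p by simp
    qed (use that in \<open>simp add: add_increasing2\<close>)
    then show "AE t in lborel. t \<in> {0..2*pi} \<longrightarrow> cmod (d t) \<le> norm (1 + cmod (d t) powr p)"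
      by (intro AE_I2) (simp add: add_nonneg_nonneg)
  qed (rule d_meas)
  have cont: "continuous_on (ball 0 1) (cauchy_transform_deriv f)"
    by (intro continuous_on_cauchy_transform_deriv abs_continuous_on_imp_continuous_on ac)
  show meas: "set_borel_measurable lborel (ball 0 1) (cauchy_transform_deriv f)"
    using borel_measurable_continuous_on_indicator[OF _ cont] by (simp add: set_borel_measurable_def)
  have cont': "continuous_on (ball 0 1) (\<lambda>z. cmod (cauchy_transform_deriv f z) powr p)"
    using cont p by (intro continuous_on_powr') (auto intro!: continuous_intros)
  have meas': "set_borel_measurable lborel (ball 0 1) (\<lambda>z. cmod (cauchy_transform_deriv f z) powr p)"
    using borel_measurable_continuous_on_indicator[OF _ cont'] by (simp add: set_borel_measurable_def)
  define I where "I = (LINT t:{0..2*pi}|lborel. cmod (d t) powr p)"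
  define c where "c = C_const p + 1 / (2 - p)"
  have c: "c \<ge> 0" using p C_const_nonneg[of p] by (simp add: c_def)
  have I: "I \<ge> 0" unfolding I_def set_lebesgue_integral_def
    by (intro Bochner_Integration.integral_nonneg) auto
  note bound = set_integrable_of_nn_integral_le[OF meas' _ _
      nn_integral_cauchy_transform_deriv_le[OF p ac per deriv d d_Lp, folded I_def c_def]]
  show "set_integrable lborel (ball 0 1) (\<lambda>z. cmod (cauchy_transform_deriv f z) powr p)"
    using c I by (intro bound) auto
  have "(LINT z:ball 0 1|lborel. cmod (cauchy_transform_deriv f z) powr p) \<le> c / 2 * I"
    using c I by (intro bound) auto
  then have "(1 / pi) * (LINT z:ball 0 1|lborel. cmod (cauchy_transform_deriv f z) powr p)
      \<le> (1 / pi) * (c / 2 * I)"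
    by (intro mult_left_mono) auto
  \<comment> \<open>The remaining 1/2 combines with 1/pi into the normalisation of the circle
    norm.\<close>
  also have "\<dots> = c * ((1 / (2 * pi)) * I)" by simp
  finally have "Lp_norm_disk p (cauchy_transform_deriv f) \<le> (c * ((1 / (2 * pi)) * I)) powr (1/p)"
    unfolding Lp_norm_disk_def using p
    by (intro powr_mono2) (auto simp: set_lebesgue_integral_def intro!: Bochner_Integration.integral_nonneg)
  also have "\<dots> = c powr (1/p) * Lp_norm_circle p d"
    using powr_mult[of c "(1 / (2 * pi)) * I" "1/p"] c I by (simp add: Lp_norm_circle_def I_def)
  finally show "Lp_norm_disk p (cauchy_transform_deriv f)
      \<le> (C_const p + 1 / (2 - p)) powr (1/p) * Lp_norm_circle p d"
    by (simp add: c_def)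
qed

section \<open>Wirtinger derivatives of the Poisson integral\<close>

lemma poisson_integral_eq_cauchy_transform:
  assumes F: "continuous_on {0..2*pi} (\<lambda>t. F (cis t))" and z: "cmod z < 1"
  shows "poisson_integral F z = cauchy_transform (\<lambda>t. F (cis t)) z
    + cnj (cauchy_transform (\<lambda>t. cnj (F (cis t))) z)
    - integral {0..2*pi} (\<lambda>t. F (cis t)) / of_real (2 * pi)"
proof -
  let ?c = "\<lambda>t. cis t / (cis t - z)"
  have c: "continuous_on {0..2*pi} ?c"
    using cis_minus_nonzero[OF z] by (auto intro!: continuous_intros)
  \<comment> \<open>The conjugate half of the kernel is written with \<open>cnj (F (cis t))\<close>
    under an outer \<open>cnj\<close>, so that the antiholomorphic part is the conjugate of a Cauchy
    transform.\<close>
  have kernel: "of_real (poisson_kernel (cmod z) (t - Arg z)) * F (cis t)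
      = (F (cis t) * ?c t + cnj (cnj (F (cis t)) * ?c t) - F (cis t)) / of_real (2 * pi)" for t
  proof -
    have "herglotz z (cis t) = (2 * ?c t - 1) / of_real (2 * pi)"
      unfolding herglotz_def using cis_minus_nonzero[OF z, of t] by (simp add: field_simps)
    then have "of_real (poisson_kernel (cmod z) (t - Arg z)) = of_real (Re ((2 * ?c t - 1) / of_real (2 * pi)))"
      using Re_herglotz_cis[OF z, of t] by simp
    also have "of_real (Re ((2 * w - 1) / of_real (2 * pi))) = (w + cnj w - 1) / of_real (2 * pi)" for w
      by (subst Re_divide_of_real) (simp add: complex_add_cnj)
    finally show ?thesis by (simp add: algebra_simps)
  qed
  have int: "(\<lambda>t. F (cis t) * ?c t) integrable_on {0..2*pi}"
    "(\<lambda>t. cnj (F (cis t)) * ?c t) integrable_on {0..2*pi}"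
    "(\<lambda>t. F (cis t)) integrable_on {0..2*pi}"
    by (intro integrable_continuous_interval continuous_on_mult continuous_on_cnj F c)+
  have "continuous_on {0..2*pi} (\<lambda>t. of_real (poisson_kernel (cmod z) (t - Arg z)) * F (cis t))"
    unfolding kernel
    by (intro continuous_on_divide continuous_on_diff continuous_on_add continuous_on_mult continuous_on_cnj
        continuous_on_const F c) auto
  then have "poisson_integral F z
      = integral {0..2*pi} (\<lambda>t. of_real (poisson_kernel (cmod z) (t - Arg z)) * F (cis t))"
    unfolding poisson_integral_def
    by (intro set_borel_integral_eq_integral(2) borel_integrable_atLeastAtMost')
  also have "\<dots> = (integral {0..2*pi} (\<lambda>t. F (cis t) * ?c t)
      + integral {0..2*pi} (\<lambda>t. cnj (cnj (F (cis t)) * ?c t))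
      - integral {0..2*pi} (\<lambda>t. F (cis t))) / of_real (2 * pi)"
    unfolding kernel integral_divide using int integrable_on_cnj_iff[of "\<lambda>t. cnj (F (cis t)) * ?c t"]
    by (subst integral_diff) (auto intro!: integrable_add simp: integral_add)
  also have "integral {0..2*pi} (\<lambda>t. cnj (cnj (F (cis t)) * ?c t))
      = cnj (integral {0..2*pi} (\<lambda>t. cnj (F (cis t)) * ?c t))"
    by (simp add: integral_cnj)
  finally show ?thesis
    by (simp add: cauchy_transform_def add_divide_distrib diff_divide_distrib)
qed

text \<open>On the disc the function is holomorphic plus antiholomorphic, with real derivative h
  \<mapsto> a h + cnj (b h). The two Wirtinger combinations of its values at 1 and i isolate a and
  cnj b.\<close>

lemma wirtinger_poisson_integral:
  assumes F: "continuous_on {0..2*pi} (\<lambda>t. F (cis t))" and z: "z \<in> ball 0 1"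
  shows "wirt_z (poisson_integral F) z = cauchy_transform_deriv (\<lambda>t. F (cis t)) z"
    and "cnj (wirt_zbar (poisson_integral F) z) = cauchy_transform_deriv (\<lambda>t. cnj (F (cis t))) z"
proof -
  let ?f = "\<lambda>t. F (cis t)" and ?g = "\<lambda>t. cnj (F (cis t))"
  let ?a = "cauchy_transform_deriv ?f z" and ?b = "cauchy_transform_deriv ?g z"
  have g: "continuous_on {0..2*pi} ?g" using F by (intro continuous_intros)
  have "((\<lambda>z. cauchy_transform ?f z + cnj (cauchy_transform ?g z) - integral {0..2*pi} ?f / of_real (2 * pi))
      has_derivative (\<lambda>h. ?a * h + cnj (?b * h) - 0)) (at z)"
    by (intro has_derivative_diff has_derivative_add has_derivative_cnj has_derivative_const
        has_field_derivative_imp_has_derivative cauchy_transform_has_field_derivative F g z)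
  then have "(poisson_integral F has_derivative (\<lambda>h. ?a * h + cnj (?b * h) - 0)) (at z)"
    using z poisson_integral_eq_cauchy_transform[OF F]
    by (elim has_derivative_transform_within_open[of _ _ _ _ "ball 0 1"]) auto
  then have D: "frechet_derivative (poisson_integral F) (at z) = (\<lambda>h. ?a * h + cnj (?b * h) - 0)"
    by (rule frechet_derivative_at[symmetric])
  show "wirt_z (poisson_integral F) z = ?a"
    unfolding wirt_z_def D by (simp add: algebra_simps)
  have "wirt_zbar (poisson_integral F) z = cnj ?b"
    unfolding wirt_zbar_def D by (simp add: algebra_simps)
  then show "cnj (wirt_zbar (poisson_integral F) z) = ?b" by simp
qed

theorem theorem1p2:
  fixes p :: real and F :: "complex \<Rightarrow> complex" and dF :: "real \<Rightarrow> complex"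
  assumes p: "1 \<le> p" "p < 2"
    and ac: "abs_continuous_on 0 (2*pi) (\<lambda>t. F (cis t))"
    and deriv: "AE t in lborel. t \<in> {0..2*pi} \<longrightarrow>
                  ((\<lambda>s. F (cis s)) has_vector_derivative dF t) (at t)"
    and dF_meas: "set_borel_measurable lborel {0..2*pi} dF"
    and dF_Lp: "set_integrable lborel {0..2*pi} (\<lambda>t. cmod (dF t) powr p)"
  shows
    "Lp_norm_disk p (wirt_z (poisson_integral F))
       \<le> (C_const p + 1 / (2 - p)) powr (1/p) * Lp_norm_circle p dF
   \<and> Lp_norm_disk p (\<lambda>z. cnj (wirt_zbar (poisson_integral F) z))
       \<le> (C_const p + 1 / (2 - p)) powr (1/p) * Lp_norm_circle p dF
   \<and> set_borel_measurable lborel (ball 0 1) (wirt_z (poisson_integral F))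
   \<and> set_integrable lborel (ball 0 1) (\<lambda>z. cmod (wirt_z (poisson_integral F) z) powr p)
   \<and> set_borel_measurable lborel (ball 0 1) (\<lambda>z. cnj (wirt_zbar (poisson_integral F) z))
   \<and> set_integrable lborel (ball 0 1)
       (\<lambda>z. cmod (cnj (wirt_zbar (poisson_integral F) z)) powr p)"
proof -
  let ?f = "\<lambda>t. F (cis t)" and ?g = "\<lambda>t. cnj (F (cis t))"
  have F: "continuous_on {0..2*pi} ?f" using ac by (rule abs_continuous_on_imp_continuous_on)
  \<comment> \<open>Conjugation is an isometry, so the conjugated boundary function satisfies the
    same assumptions with derivative \<open>cnj (dF t)\<close> of equal norm; the second estimate is
    the first one applied to it.\<close>
  have "abs_continuous_on 0 (2*pi) ?g"
    using ac unfolding abs_continuous_on_def by (simp flip: complex_cnj_diff)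
  moreover have "AE t in lborel. t \<in> {0..2*pi} \<longrightarrow> (?g has_vector_derivative cnj (dF t)) (at t)"
    using deriv by eventually_elim (auto intro: has_vector_derivative_cnj)
  moreover have "set_borel_measurable lborel {0..2*pi} (\<lambda>t. cnj (dF t))"
    using measurable_compose[OF dF_meas[unfolded set_borel_measurable_def], of cnj borel]
    by (simp add: set_borel_measurable_def borel_measurable_continuous_onI continuous_intros)
  ultimately have g: "set_borel_measurable lborel (ball 0 1) (cauchy_transform_deriv ?g)"
    "set_integrable lborel (ball 0 1) (\<lambda>z. cmod (cauchy_transform_deriv ?g z) powr p)"
    "Lp_norm_disk p (cauchy_transform_deriv ?g) \<le> (C_const p + 1 / (2 - p)) powr (1/p) * Lp_norm_circle p dF"
    using cauchy_transform_deriv_Lp[OF p, of ?g "\<lambda>t. cnj (dF t)"] dF_Lp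
    by (simp_all add: Lp_norm_circle_def)
  \<comment> \<open>The periodicity premise is automatic, since \<open>cis (2*pi)\<close> and
    \<open>cis 0\<close> coincide.\<close>
  have f: "set_borel_measurable lborel (ball 0 1) (cauchy_transform_deriv ?f)"
    "set_integrable lborel (ball 0 1) (\<lambda>z. cmod (cauchy_transform_deriv ?f z) powr p)"
    "Lp_norm_disk p (cauchy_transform_deriv ?f) \<le> (C_const p + 1 / (2 - p)) powr (1/p) * Lp_norm_circle p dF"
    using cauchy_transform_deriv_Lp[OF p ac _ deriv dF_meas dF_Lp] by simp_all
  \<comment> \<open>The Wirtinger derivatives are identified only inside the disc, and all three
    notions see a function only there.\<close>
  have disk_cong: "Lp_norm_disk p u = Lp_norm_disk p v
      \<and> set_borel_measurable lborel (ball 0 1) u = set_borel_measurable lborel (ball 0 1) v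
      \<and> set_integrable lborel (ball 0 1) (\<lambda>z. cmod (u z) powr p) = set_integrable lborel (ball 0 1) (\<lambda>z. cmod (v z) powr p)"
    if "\<And>z. z \<in> ball 0 1 \<Longrightarrow> u z = v z" for u v :: "complex \<Rightarrow> complex"
  proof -
    have "(\<lambda>z. indicator (ball 0 1) z *\<^sub>R u z) = (\<lambda>z. indicator (ball 0 1) z *\<^sub>R v z)"
      "(\<lambda>z. indicator (ball 0 1) z *\<^sub>R cmod (u z) powr p) = (\<lambda>z. indicator (ball 0 1) z *\<^sub>R cmod (v z) powr p)"
      using that by (auto simp: fun_eq_iff split: split_indicator)
    then show ?thesis
      unfolding Lp_norm_disk_def set_lebesgue_integral_def set_borel_measurable_def set_integrable_def by metis
  qed
  show ?thesis
    using f g disk_cong[OF wirtinger_poisson_integral(1)[OF F]] disk_cong[OF wirtinger_poisson_integral(2)[OF F]]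
    by simp
qed

end
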